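(* The class of diagram groups is closed under restricted wreath products with the infinite cyclic group $\mathbf{Z}$; that is, if $G$ is a diagram group, then the restricted wreath product $G\wr\mathbf{Z}$ is also a diagram group.
   Context: $G\wr\mathbf{Z}$ is the semidirect product of the direct sum $\bigoplus_{i\in\mathbf{Z}}G_i$ of copies $G_i$ of $G$ with $\mathbf{Z}$, a generator of $\mathbf{Z}$ acting by the shift $G_i\to G_{i+1}$. Diagram groups. A semigroup presentation $\mathcal{P}=\langle\Sigma\mid\mathcal{R}\rangle$ consists of an alphabet $\Sigma$ and a set $\mathcal{R}$ of pairs $(u,v)$ of non-empty words over $\Sigma$, written $u=v$; presentations are assumed anti-symmetric: if $(u=v)\in\mathcal{R}$ then $(v=u)\notin\mathcal{R}$. $\Sigma^+$ and $\Sigma^*$ are the free semigroup and free monoid on $\Sigma$. The graph $\Gamma(\mathcal{P})$ has vertex set $\Sigma^+$ and an edge $(p,u\to v,q)$ from $puq$ to $pvq$ for all $p,q\in\Sigma^*$ and all $u,v$ with $(u=v)\in\mathcal{R}$ or $(v=u)\in\mathcal{R}$; the inverse edge is $(p,v\to u,q)$. The Squier complex $\mathcal{K}(\mathcal{P})$ is the 2-complex obtained from $\Gamma(\mathcal{P})$ by attaching, for all $p,z,q\in\Sigma^*$ and $(\ell_1=r_1),(\ell_2=r_2)\in\mathcal{R}$, a 2-cell along the closed path $p_1p_2^{-1}$, where $p_1=(p,\ell_1\to r_1,z\ell_2q)(pr_1z,\ell_2\to r_2,q)$ and $p_2=(p\ell_1z,\ell_2\to r_2,q)(p,\ell_1\to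 r_1,zr_2q)$. For $w\in\Sigma^+$ the diagram group $\mathcal{D}(\mathcal{P},w)$ is (up to isomorphism, by Kilibarda's theorem; this may be taken as the definition) the fundamental group $\pi_1(\mathcal{K}(\mathcal{P}),w)$. A group is a diagram group if it is isomorphic to some $\mathcal{D}(\mathcal{P},w)$. *)

theory Defs
  imports "HOL-Algebra.Elementary_Groups" "HOL-Algebra.Product_Groups"
begin

section \<open>Combinatorial 2-complexes and their fundamental groups\<close>

text \<open>
  Graphs are taken in the sense of Serre: every edge e has an inverse edge. The set \<open>cells\<close>
  consists of the closed edge paths along which the 2-cells are attached. The fundamental group is
  the combinatorial (edge-path) one: homotopy of edge paths is the equivalence relation generated by
  cancelling a subpath that consists of an edge followed by its inverse and by cancelling the
  boundary path of a 2-cell.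
\<close>

record ('v, 'e) two_complex =
  verts :: "'v set"
  edges :: "'e set"
  src :: "'e \<Rightarrow> 'v"
  tgt :: "'e \<Rightarrow> 'v"
  inv_edge :: "'e \<Rightarrow> 'e"
  cells :: "'e list set"

fun is_path :: "('v, 'e) two_complex \<Rightarrow> 'v \<Rightarrow> 'e list \<Rightarrow> 'v \<Rightarrow> bool" where
  "is_path K x [] y \<longleftrightarrow> x \<in> verts K \<and> x = y"
| "is_path K x (e # es) y \<longleftrightarrow> x \<in> verts K \<and> e \<in> edges K \<and> src K e = x \<and> is_path K (tgt K e) es y"

definition inv_path :: "('v, 'e) two_complex \<Rightarrow> 'e list \<Rightarrow> 'e list" where
  "inv_path K es = rev (map (inv_edge K) es)"

text \<open>
  Only the boundary paths in \<open>cells\<close> themselves are cancelled; for their inverses and cyclic shifts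
  this follows with the help of \<open>cancel_edge\<close>.
\<close>

inductive homotopic ::
  "('v, 'e) two_complex \<Rightarrow> 'v \<Rightarrow> 'v \<Rightarrow> 'e list \<Rightarrow> 'e list \<Rightarrow> bool"
  for K :: "('v, 'e) two_complex" and x y :: 'v where
  refl: "is_path K x r y \<Longrightarrow> homotopic K x y r r"
| sym: "homotopic K x y r s \<Longrightarrow> homotopic K x y s r"
| trans: "homotopic K x y r s \<Longrightarrow> homotopic K x y s t \<Longrightarrow> homotopic K x y r t"
| cancel_edge: "is_path K x (r @ [e, inv_edge K e] @ s) y \<Longrightarrow> is_path K x (r @ s) y \<Longrightarrow>
    homotopic K x y (r @ [e, inv_edge K e] @ s) (r @ s)"
| cancel_cell: "c \<in> cells K \<Longrightarrow> is_path K x (r @ c @ s) y \<Longrightarrow> is_path K x (r @ s) y \<Longrightarrow>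
    homotopic K x y (r @ c @ s) (r @ s)"

definition homotopy_rel :: "('v, 'e) two_complex \<Rightarrow> 'v \<Rightarrow> ('e list \<times> 'e list) set" where
  "homotopy_rel K x = {(r, s). homotopic K x x r s}"

definition fundamental_group :: "('v, 'e) two_complex \<Rightarrow> 'v \<Rightarrow> 'e list set monoid" where
  "fundamental_group K x =
    \<lparr>carrier = {r. is_path K x r x} // homotopy_rel K x,
     monoid.mult = (\<lambda>A B. \<Union>r\<in>A. \<Union>s\<in>B. homotopy_rel K x `` {r @ s}),
     one = homotopy_rel K x `` {[]}\<rparr>"


section \<open>Diagram groups\<close>

record 'a semigroup_presentation =
  alphabet :: "'a set"
  relations :: "('a list \<times> 'a list) set"

abbreviation nonempty_words :: "'a set \<Rightarrow> 'a list set" where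
  "nonempty_words \<Sigma> \<equiv> lists \<Sigma> - {[]}"

definition is_presentation :: "'a semigroup_presentation \<Rightarrow> bool" where
  "is_presentation P \<longleftrightarrow>
    relations P \<subseteq> nonempty_words (alphabet P) \<times> nonempty_words (alphabet P) \<and>
    (\<forall>u v. (u, v) \<in> relations P \<longrightarrow> (v, u) \<notin> relations P)"

text \<open>The tuple (p, u, v, q) stands for the edge from puq to pvq that replaces u by v.\<close>

type_synonym 'a edge = "'a list \<times> 'a list \<times> 'a list \<times> 'a list"

definition squier_edges :: "'a semigroup_presentation \<Rightarrow> 'a edge set" where
  "squier_edges P = {(p, u, v, q) | p u v q. p \<in> lists (alphabet P) \<and> q \<in> lists (alphabet P) \<and>
    ((u, v) \<in> relations P \<or> (v, u) \<in> relations P)}"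

definition squier_src :: "'a edge \<Rightarrow> 'a list" where
  "squier_src = (\<lambda>(p, u, v, q). p @ u @ q)"

definition squier_tgt :: "'a edge \<Rightarrow> 'a list" where
  "squier_tgt = (\<lambda>(p, u, v, q). p @ v @ q)"

definition squier_inv :: "'a edge \<Rightarrow> 'a edge" where
  "squier_inv = (\<lambda>(p, u, v, q). (p, v, u, q))"

definition squier_graph :: "'a semigroup_presentation \<Rightarrow> ('a list, 'a edge) two_complex" where
  "squier_graph P =
    \<lparr>verts = nonempty_words (alphabet P), edges = squier_edges P,
     src = squier_src, tgt = squier_tgt, inv_edge = squier_inv, cells = {}\<rparr>"

definition squier_cells :: "'a semigroup_presentation \<Rightarrow> 'a edge list set" where
  "squier_cells P =
    {p1 @ inv_path (squier_graph P) p2 | p1 p2 p z q l1 r1 l2 r2.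
      p \<in> lists (alphabet P) \<and> z \<in> lists (alphabet P) \<and> q \<in> lists (alphabet P) \<and>
      (l1, r1) \<in> relations P \<and> (l2, r2) \<in> relations P \<and>
      p1 = [(p, l1, r1, z @ l2 @ q), (p @ r1 @ z, l2, r2, q)] \<and>
      p2 = [(p @ l1 @ z, l2, r2, q), (p, l1, r1, z @ r2 @ q)]}"

definition squier_complex :: "'a semigroup_presentation \<Rightarrow> ('a list, 'a edge) two_complex" where
  "squier_complex P = (squier_graph P)\<lparr>cells := squier_cells P\<rparr>"

definition diagram_group_of :: "'a semigroup_presentation \<Rightarrow> 'a list \<Rightarrow> 'a edge list set monoid" where
  "diagram_group_of P w = fundamental_group (squier_complex P) w"

text \<open>
  HOL cannot quantify over types inside a formula, so the type from which the letters of the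
  presentation are drawn is a parameter, in the role of a universe bounding the size of the
  alphabet. The alphabet itself is an arbitrary subset of that type. A construction that needs fresh
  letters besides an arbitrary alphabet over 'a moves to a larger type such as \<open>'a + nat\<close>.
\<close>

definition is_diagram_group :: "'a itself \<Rightarrow> ('g, 'm) monoid_scheme \<Rightarrow> bool" where
  "is_diagram_group A G \<longleftrightarrow> group G \<and>
    (\<exists>(P :: 'a semigroup_presentation) w.
      is_presentation P \<and> w \<in> nonempty_words (alphabet P) \<and> G \<cong> diagram_group_of P w)"


section \<open>Restricted wreath products with the integers\<close>

definition semidirect_product ::
  "('n, 'p) monoid_scheme \<Rightarrow> ('h, 'q) monoid_scheme \<Rightarrow> ('h \<Rightarrow> 'n \<Rightarrow> 'n) \<Rightarrow> ('n \<times> 'h) monoid" where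
  "semidirect_product N H \<phi> =
    \<lparr>carrier = carrier N \<times> carrier H,
     monoid.mult = (\<lambda>(a, h) (b, k). (a \<otimes>\<^bsub>N\<^esub> \<phi> h b, h \<otimes>\<^bsub>H\<^esub> k)),
     one = (\<one>\<^bsub>N\<^esub>, \<one>\<^bsub>H\<^esub>)\<rparr>"

text \<open>The generator 1 of the integers moves the copy of G at index i to the copy at index i + 1.\<close>

definition shift :: "int \<Rightarrow> (int \<Rightarrow> 'g) \<Rightarrow> (int \<Rightarrow> 'g)" where
  "shift n f = (\<lambda>i. f (i - n))"

definition wreath_Z :: "('g, 'm) monoid_scheme \<Rightarrow> ((int \<Rightarrow> 'g) \<times> int) monoid" where
  "wreath_Z G = semidirect_product (sum_group (UNIV :: int set) (\<lambda>_. G)) integer_group shift"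

end

theory Submission
  imports Defs
begin

text \<open>
  Let G be the fundamental group at w of the Squier complex of a presentation P. Four new letters
  are added to P: brackets, written s and t here, and end markers a and c. The new relations are
  a s w t = a and s w t c = c. They leave the relations of P alone inside the brackets, so the words
  in the component of a c are exactly the words a (s u1 t) ... (s un t) c in which every ui is equal
  to w modulo P. A block can only be created or deleted next to a or c, and only while its content is
  w itself; the two brackets guarantee this even if, say, w and w w are equal modulo P.

  Each path is labelled by an element of the wreath product. A rewriting step inside a block is
  labelled by its element of G, placed in the copy whose index is the position of the block. A block
  that a absorbs moves all later blocks one position to the left, so this step is labelled by the
  generator of the integers. A block that c absorbs moves nothing, so this step is labelled by 1. The
  2-cells of the Squier complex commute steps in disjoint factors of a word, and the labels commute in
  the same way: a cell inside one block is a cell of P, steps in different blocks have labels in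
  different copies of G, and a step of a conjugates copy i to copy i + 1. However, the relations
  a s w t = a and s w t c = c overlap in the word a s w t c, and no 2-cell prevents the loop T that
  creates a block at c and absorbs it into a from having infinite order. Hence the labels define a
  homomorphism on the fundamental group at a c, which maps T to the generator of the integers, and
  maps the loop that creates a block at c, runs a loop g at w inside it and deletes it again, to g in
  copy 0.

  To see that this homomorphism is bijective, every path from a c is brought into a normal form: first
  a product of T and of the loops coming from G, then the creation of all blocks from left to right,
  each rewritten from w to its content as soon as it exists (\<open>path_normal_form\<close>). This only uses the
  interchange law for paths in disjoint factors (\<open>interchange\<close>). For a loop the second part is
  empty, so T and the image of G generate the fundamental group. Conjugating the image of G by the
  k-th power of T gives the loops that run inside block number k (\<open>loop_at_conjugate\<close>), which commute
  with those inside block number 0 when k is positive (\<open>loop_at_commute\<close>). These relations together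
  with the homomorphism characterise the wreath product (\<open>wreath_Z_recognition\<close>).
\<close>


section \<open>Homotopy of edge paths\<close>

lemma is_path_verts:
  "is_path K x r y \<Longrightarrow> x \<in> verts K \<and> y \<in> verts K"
  by (induction r arbitrary: x) auto

lemma is_path_append:
  "is_path K x (r @ s) z \<longleftrightarrow> (\<exists>y. is_path K x r y \<and> is_path K y s z)"
proof (induction r arbitrary: x)
  case Nil
  then show ?case using is_path_verts[of K x s z] by auto
next
  case (Cons e r)
  then show ?case by auto
qed

lemma is_path_appendI:
  "is_path K x r y \<Longrightarrow> is_path K y s z \<Longrightarrow> is_path K x (r @ s) z"
  by (auto simp: is_path_append)

lemma homotopic_is_path:
  "homotopic K x y r s \<Longrightarrow> is_path K x r y \<and> is_path K x s y"
  by (induction rule: homotopic.induct) auto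

lemma homotopic_context:
  assumes "homotopic K x y s s'" "is_path K a p x" "is_path K y q b"
  shows "homotopic K a b (p @ s @ q) (p @ s' @ q)"
  using assms
proof (induction rule: homotopic.induct)
  case (refl r)
  then show ?case by (meson homotopic.refl is_path_append)
next
  case (sym r s)
  then show ?case by (blast intro: homotopic.sym)
next
  case (trans r s t)
  then show ?case by (blast intro: homotopic.trans)
next
  case (cancel_edge r e s)
  have "is_path K a ((p @ r) @ [e, inv_edge K e] @ (s @ q)) b" "is_path K a ((p @ r) @ (s @ q)) b"
    using cancel_edge is_path_append[of K a p "(r @ [e, inv_edge K e] @ s) @ q" b]
      is_path_append[of K a p "(r @ s) @ q" b] is_path_appendI by fastforce+
  from homotopic.cancel_edge[OF this] show ?case by simp
next
  case (cancel_cell c r s)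
  have "is_path K a ((p @ r) @ c @ (s @ q)) b" "is_path K a ((p @ r) @ (s @ q)) b"
    using cancel_cell is_path_append[of K a p "(r @ c @ s) @ q" b]
      is_path_append[of K a p "(r @ s) @ q" b] is_path_appendI by fastforce+
  from homotopic.cancel_cell[OF cancel_cell.hyps(1) this] show ?case by simp
qed

lemma homotopic_append:
  assumes "homotopic K x y r r'" "homotopic K y z s s'"
  shows "homotopic K x z (r @ s) (r' @ s')"
proof -
  have p: "is_path K x r y" "is_path K x r' y" "is_path K y s z" "is_path K y s' z"
    using homotopic_is_path assms by metis+
  have "homotopic K x z ([] @ r @ s) ([] @ r' @ s)"
    using assms(1) p is_path_verts[OF p(1)] by (intro homotopic_context) auto
  moreover have "homotopic K x z (r' @ s @ []) (r' @ s' @ [])"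
    using assms(2) p is_path_verts[OF p(4)] by (intro homotopic_context) auto
  ultimately show ?thesis by (auto intro: homotopic.trans)
qed

lemma homotopic_appendL:
  "is_path K x r y \<Longrightarrow> homotopic K y z s s' \<Longrightarrow> homotopic K x z (r @ s) (r @ s')"
  by (intro homotopic_append homotopic.refl)

lemma homotopic_appendR:
  "homotopic K x y r r' \<Longrightarrow> is_path K y s z \<Longrightarrow> homotopic K x z (r @ s) (r' @ s)"
  by (intro homotopic_append homotopic.refl)

lemmas homotopic_trans [trans] = homotopic.trans

lemma inv_path_Nil [simp]: "inv_path K [] = []"
  and inv_path_append: "inv_path K (r @ s) = inv_path K s @ inv_path K r"
  and inv_path_Cons: "inv_path K (e # r) = inv_path K r @ [inv_edge K e]"
  by (simp_all add: inv_path_def)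

locale serre_complex =
  fixes K :: "('v, 'e) two_complex"
  assumes inv_edge_closed: "e \<in> edges K \<Longrightarrow> inv_edge K e \<in> edges K"
    and src_inv_edge: "e \<in> edges K \<Longrightarrow> src K (inv_edge K e) = tgt K e"
    and tgt_inv_edge: "e \<in> edges K \<Longrightarrow> tgt K (inv_edge K e) = src K e"
    and inv_inv_edge: "e \<in> edges K \<Longrightarrow> inv_edge K (inv_edge K e) = e"
begin

lemma is_path_inv_path:
  "is_path K x r y \<Longrightarrow> is_path K y (inv_path K r) x"
proof (induction r arbitrary: x)
  case (Cons e r)
  then have "is_path K (tgt K e) [inv_edge K e] x"
    using is_path_verts[of K "tgt K e" r y]
    by (auto simp: inv_edge_closed src_inv_edge tgt_inv_edge)
  moreover have "is_path K y (inv_path K r) (tgt K e)" using Cons by simp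
  ultimately show ?case
    using is_path_appendI by (fastforce simp: inv_path_Cons)
qed simp

lemma inv_path_inv_path:
  "is_path K x r y \<Longrightarrow> inv_path K (inv_path K r) = r"
  by (induction r arbitrary: x) (auto simp: inv_path_Cons inv_path_append inv_inv_edge)

lemma homotopic_inv_path_right:
  "is_path K x r y \<Longrightarrow> homotopic K x x (r @ inv_path K r) []"
proof (induction r arbitrary: x)
  case (Cons e r)
  let ?z = "tgt K e"
  have e: "is_path K x [e] ?z" "is_path K ?z [inv_edge K e] x"
    using Cons.prems is_path_verts[of K ?z r y]
    by (auto simp: inv_edge_closed src_inv_edge tgt_inv_edge)
  have "homotopic K x x ([e] @ (r @ inv_path K r) @ [inv_edge K e]) ([e] @ [] @ [inv_edge K e])"
    using Cons e by (intro homotopic_context) auto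
  also have "homotopic K x x ([] @ [e, inv_edge K e] @ []) ([] @ [])"
    using is_path_appendI[OF e] Cons.prems by (intro homotopic.cancel_edge) auto
  then have "homotopic K x x ([e] @ [] @ [inv_edge K e]) []" by simp
  finally show ?case by (simp add: inv_path_Cons)
qed (auto intro: homotopic.refl)

lemma homotopic_inv_path_left:
  assumes "is_path K x r y"
  shows "homotopic K y y (inv_path K r @ r) []"
  using homotopic_inv_path_right[OF is_path_inv_path[OF assms]] inv_path_inv_path[OF assms] by simp

lemma homotopic_cancel_left:
  assumes "is_path K x r y" "is_path K y s z"
  shows "homotopic K y z (inv_path K r @ r @ s) s"
  using homotopic_appendR[OF homotopic_inv_path_left[OF assms(1)] assms(2)] by simp

end


section \<open>Fundamental groups and edge labellings\<close>

abbreviation homotopy_class :: "('v, 'e) two_complex \<Rightarrow> 'v \<Rightarrow> 'e list \<Rightarrow> 'e list set" where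
  "homotopy_class K x r \<equiv> homotopy_rel K x `` {r}"

lemma equiv_homotopy_rel: "equiv {r. is_path K x r x} (homotopy_rel K x)"
  unfolding homotopy_rel_def
  by (intro equivI refl_onI symI transI) 
    (auto intro: homotopic.intros dest: homotopic_is_path)

lemma homotopy_class_eq_iff:
  assumes "is_path K x r x"
  shows "homotopy_class K x r = homotopy_class K x s \<longleftrightarrow> homotopic K x x r s"
proof
  assume "homotopy_class K x r = homotopy_class K x s"
  moreover have "r \<in> homotopy_class K x r"
    using assms by (auto simp: homotopy_rel_def intro: homotopic.refl)
  ultimately show "homotopic K x x r s"
    by (auto simp: homotopy_rel_def intro: homotopic.sym)
qed (auto simp: homotopy_rel_def intro: homotopic.trans homotopic.sym)

lemma homotopy_class_in_carrier:
  "is_path K x r x \<Longrightarrow> homotopy_class K x r \<in> carrier (fundamental_group K x)"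
  by (auto simp: fundamental_group_def intro: quotientI)

lemma fundamental_group_cases:
  assumes "A \<in> carrier (fundamental_group K x)"
  obtains r where "is_path K x r x" "A = homotopy_class K x r"
  using assms by (auto simp: fundamental_group_def elim: quotientE)

lemma mult_homotopy_class:
  assumes "is_path K x r x" "is_path K x s x"
  shows "homotopy_class K x r \<otimes>\<^bsub>fundamental_group K x\<^esub> homotopy_class K x s =
    homotopy_class K x (r @ s)"
proof -
  have "congruent2 (homotopy_rel K x) (homotopy_rel K x) (\<lambda>r s. homotopy_class K x (r @ s))"
  proof (rule congruent2I')
    fix r r' s s'
    assume "(r, r') \<in> homotopy_rel K x" "(s, s') \<in> homotopy_rel K x"
    then have "homotopic K x x (r @ s) (r' @ s')"
      by (auto simp: homotopy_rel_def intro: homotopic_append)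
    then show "homotopy_class K x (r @ s) = homotopy_class K x (r' @ s')"
      using homotopy_class_eq_iff homotopic_is_path by metis
  qed
  from UN_equiv_class2[OF equiv_homotopy_rel equiv_homotopy_rel this] assms
  show ?thesis by (simp add: fundamental_group_def)
qed

lemma one_fundamental_group: "\<one>\<^bsub>fundamental_group K x\<^esub> = homotopy_class K x []"
  by (simp add: fundamental_group_def)

lemma (in serre_complex) group_fundamental_group:
  assumes "x \<in> verts K"
  shows "group (fundamental_group K x)"
proof (rule groupI)
  fix A B C
  assume "A \<in> carrier (fundamental_group K x)" "B \<in> carrier (fundamental_group K x)"
    "C \<in> carrier (fundamental_group K x)"
  then show "A \<otimes>\<^bsub>fundamental_group K x\<^esub> B \<otimes>\<^bsub>fundamental_group K x\<^esub> C =
      A \<otimes>\<^bsub>fundamental_group K x\<^esub> (B \<otimes>\<^bsub>fundamental_group K x\<^esub> C)"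
    by (elim fundamental_group_cases) (simp add: mult_homotopy_class is_path_appendI)
next
  fix A
  assume "A \<in> carrier (fundamental_group K x)"
  then obtain r where r: "is_path K x r x" "A = homotopy_class K x r"
    by (rule fundamental_group_cases)
  from r(1) have "homotopy_class K x (inv_path K r @ r) = homotopy_class K x []"
    using homotopic_inv_path_left homotopy_class_eq_iff homotopic_is_path by metis
  with r show "\<exists>B\<in>carrier (fundamental_group K x). B \<otimes>\<^bsub>fundamental_group K x\<^esub> A = \<one>\<^bsub>fundamental_group K x\<^esub>"
    by (intro bexI[of _ "homotopy_class K x (inv_path K r)"])
      (auto simp: mult_homotopy_class is_path_inv_path one_fundamental_group
        intro: homotopy_class_in_carrier)
qed (use assms in \<open>auto elim!: fundamental_group_cases
    simp: mult_homotopy_class one_fundamental_group is_path_appendI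
    intro!: homotopy_class_in_carrier\<close>)

lemma (in serre_complex) inv_homotopy_class:
  assumes "is_path K x r x"
  shows "inv\<^bsub>fundamental_group K x\<^esub> (homotopy_class K x r) = homotopy_class K x (inv_path K r)"
proof -
  interpret group "fundamental_group K x"
    using assms is_path_verts group_fundamental_group by metis
  have "homotopy_class K x (inv_path K r @ r) = homotopy_class K x []"
    using assms homotopic_inv_path_left homotopy_class_eq_iff homotopic_is_path by metis
  then show ?thesis
    using assms
    by (intro inv_equality)
      (auto simp: mult_homotopy_class is_path_inv_path one_fundamental_group
        intro: homotopy_class_in_carrier)
qed

definition path_label :: "('m, 'b) monoid_scheme \<Rightarrow> ('e \<Rightarrow> 'm) \<Rightarrow> 'e list \<Rightarrow> 'm" where
  "path_label M \<rho> r = foldr (\<lambda>e g. \<rho> e \<otimes>\<^bsub>M\<^esub> g) r \<one>\<^bsub>M\<^esub>"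

lemma path_label_simps [simp]:
  "path_label M \<rho> [] = \<one>\<^bsub>M\<^esub>"
  "path_label M \<rho> (e # r) = \<rho> e \<otimes>\<^bsub>M\<^esub> path_label M \<rho> r"
  by (simp_all add: path_label_def)

context group
begin

lemma path_label_closed [simp]:
  "(\<And>e. \<rho> e \<in> carrier G) \<Longrightarrow> path_label G \<rho> r \<in> carrier G"
  by (induction r) auto

lemma path_label_append:
  "(\<And>e. \<rho> e \<in> carrier G) \<Longrightarrow> path_label G \<rho> (r @ s) = path_label G \<rho> r \<otimes> path_label G \<rho> s"
  by (induction r) (auto simp: m_assoc)

end

text \<open>
  Only edges and cells that a path from x meets have to be respected. This matters for the wreath
  product: its labelling fails on cells around words that do not decompose into blocks.
\<close>

lemma (in group) path_label_homotopic:
  assumes closed: "\<And>e. \<rho> e \<in> carrier G"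
    and inverse: "\<And>r e y. is_path K x (r @ [e, inv_edge K e]) y \<Longrightarrow>
      path_label G \<rho> [e, inv_edge K e] = \<one>"
    and cell: "\<And>r c y. c \<in> cells K \<Longrightarrow> is_path K x (r @ c) y \<Longrightarrow> path_label G \<rho> c = \<one>"
    and "homotopic K x y r s"
  shows "path_label G \<rho> r = path_label G \<rho> s"
  using assms(4)
proof (induction rule: homotopic.induct)
  case (cancel_edge r e s)
  then obtain z where "is_path K x (r @ [e, inv_edge K e]) z"
    by (metis append_assoc is_path_append)
  from inverse[OF this] show ?case
    unfolding path_label_append[where \<rho> = \<rho>, OF closed] by (simp add: closed)
next
  case (cancel_cell c r s)
  then obtain z where "is_path K x (r @ c) z"
    by (metis append_assoc is_path_append)
  from cell[OF cancel_cell.hyps(1) this] show ?case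
    by (simp add: path_label_append closed)
qed auto

text \<open>
  A group isomorphic to the fundamental group is captured by labels of edges: after a choice of a path
  \<open>\<gamma> u\<close> from x to each vertex u of its component, an edge from u to v is labelled by the class of the
  loop \<open>\<gamma> u\<close>, edge, reversed \<open>\<gamma> v\<close>. Labels of single edges, unlike classes of loops, can be combined
  with the positions at which the edges act in a longer word.
\<close>

lemma (in serre_complex) ex_faithful_labelling:
  assumes G: "group G" and iso: "G \<cong> fundamental_group K x" and x: "x \<in> verts K"
  obtains \<rho> where
    "\<And>e. \<rho> e \<in> carrier G"
    "\<And>u v r s. homotopic K u v r s \<Longrightarrow> path_label G \<rho> r = path_label G \<rho> s"
    "\<And>r s. is_path K x r x \<Longrightarrow> is_path K x s x \<Longrightarrow> path_label G \<rho> r = path_label G \<rho> s \<Longrightarrow>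
      homotopic K x x r s"
    "\<And>g. g \<in> carrier G \<Longrightarrow> \<exists>r. is_path K x r x \<and> path_label G \<rho> r = g"
proof -
  interpret G: group G by fact
  let ?F = "fundamental_group K x"
  interpret F: group ?F by (rule group_fundamental_group) fact
  have "?F \<cong> G" using iso G.iso_sym by blast
  then obtain \<psi> where psi: "\<psi> \<in> iso ?F G" by (auto simp: is_iso_def)
  then have hom: "\<psi> \<in> hom ?F G" and bij: "bij_betw \<psi> (carrier ?F) (carrier G)"
    by (auto simp: iso_def)
  interpret h: group_hom ?F G \<psi>
    by (unfold_locales) (rule hom)
  \<comment> \<open>With the empty path at x the label of a loop at x is its class itself, not a conjugate.\<close>
  define \<gamma> where "\<gamma> u = (if u = x then [] else SOME r. is_path K x r u)" for u
  define comp where "comp = {u. \<exists>r. is_path K x r u}"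
  have gam: "is_path K x (\<gamma> u) u" if "u \<in> comp" for u
    using that x unfolding \<gamma>_def comp_def by (auto intro: someI)
  have comp: "u \<in> comp \<longleftrightarrow> v \<in> comp" if "is_path K u r v" for u v r
    using that is_path_inv_path[OF that] unfolding comp_def by (auto intro: is_path_appendI)
  define lp where "lp u r v = \<gamma> u @ r @ inv_path K (\<gamma> v)" for u r v
  have lp: "is_path K x (lp u r v) x" if "is_path K u r v" "u \<in> comp" for u r v
    using that comp[OF that(1)] unfolding lp_def
    by (meson gam is_path_appendI is_path_inv_path)
  define \<rho> where "\<rho> e = (if e \<in> edges K \<and> src K e \<in> comp \<and> tgt K e \<in> verts K then
      \<psi> (homotopy_class K x (lp (src K e) [e] (tgt K e))) else \<one>\<^bsub>G\<^esub>)" for e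
  have edge_path: "is_path K (src K e) [e] (tgt K e)"
    if "e \<in> edges K" "src K e \<in> comp" "tgt K e \<in> verts K" for e
    using that is_path_verts[OF gam[OF that(2)]] by auto
  have closed: "\<rho> e \<in> carrier G" for e
    unfolding \<rho>_def using edge_path lp
    by (auto intro!: h.hom_closed homotopy_class_in_carrier simp del: is_path.simps)
  have label: "path_label G \<rho> r = \<psi> (homotopy_class K x (lp u r v))"
    if "is_path K u r v" "u \<in> comp" for u r v
    using that
  proof (induction r arbitrary: u)
    case Nil
    then have "homotopic K x x (lp u [] v) []"
      using homotopic_inv_path_right[OF gam] by (auto simp: lp_def)
    then have "homotopy_class K x (lp u [] v) = \<one>\<^bsub>?F\<^esub>"
      using lp[OF Nil] homotopy_class_eq_iff one_fundamental_group by metis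
    then show ?case by simp
  next
    case (Cons e r)
    let ?z = "tgt K e"
    have e: "is_path K u [e] ?z" "is_path K ?z r v" "?z \<in> comp"
      using Cons.prems is_path_verts[of K ?z r v] comp[of u "[e]" ?z] by auto
    have "lp u [e] ?z @ lp ?z r v = (\<gamma> u @ [e]) @ (inv_path K (\<gamma> ?z) @ \<gamma> ?z) @ (r @ inv_path K (\<gamma> v))"
      by (simp add: lp_def)
    moreover have "is_path K x (\<gamma> u @ [e]) ?z" "is_path K ?z (r @ inv_path K (\<gamma> v)) x"
      using is_path_appendI[OF gam[OF Cons.prems(2)] e(1)]
        is_path_appendI[OF e(2) is_path_inv_path[OF gam]] comp[OF e(2)] e(3) by auto
    then have "homotopic K x x ((\<gamma> u @ [e]) @ (inv_path K (\<gamma> ?z) @ \<gamma> ?z) @ (r @ inv_path K (\<gamma> v)))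
       ((\<gamma> u @ [e]) @ [] @ (r @ inv_path K (\<gamma> v)))"
      by (rule homotopic_context[OF homotopic_inv_path_left[OF gam[OF e(3)]]])
    ultimately have "homotopic K x x (lp u [e] ?z @ lp ?z r v) (lp u (e # r) v)"
      by (simp add: lp_def)
    then have "homotopy_class K x (lp u (e # r) v) =
        homotopy_class K x (lp u [e] ?z) \<otimes>\<^bsub>?F\<^esub> homotopy_class K x (lp ?z r v)"
      using lp[OF e(1) Cons.prems(2)] lp[OF e(2,3)]
      by (metis mult_homotopy_class homotopy_class_eq_iff is_path_appendI)
    moreover have "\<rho> e = \<psi> (homotopy_class K x (lp u [e] ?z))"
      using Cons.prems e is_path_verts[OF e(2)] by (auto simp: \<rho>_def)
    ultimately show ?case
      using Cons.IH[OF e(2,3)] lp[OF e(1) Cons.prems(2)] lp[OF e(2,3)]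
      by (simp add: homotopy_class_in_carrier)
  qed
  have trivial: "path_label G \<rho> r = \<one>\<^bsub>G\<^esub>" if "is_path K u r v" "u \<notin> comp" for u r v
    using that
  proof (induction r arbitrary: u)
    case (Cons e r)
    have "tgt K e \<notin> comp" 
      using Cons.prems is_path_verts[of K "tgt K e" r v] comp[of u "[e]" "tgt K e"] by auto
    then show ?case using Cons by (auto simp: \<rho>_def)
  qed simp
  have loop: "path_label G \<rho> r = \<psi> (homotopy_class K x r)" if "is_path K x r x" for r
    using label[OF that] that by (auto simp: lp_def \<gamma>_def comp_def)
  show thesis
  proof
    fix u v r s assume h: "homotopic K u v r s"
    then have p: "is_path K u r v" "is_path K u s v" by (auto dest: homotopic_is_path)
    show "path_label G \<rho> r = path_label G \<rho> s"
    proof (cases "u \<in> comp")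
      case True
      then have "homotopic K x x (lp u r v) (lp u s v)"
        unfolding lp_def using h gam comp[OF p(1)] by (intro homotopic_context is_path_inv_path) auto
      then show ?thesis using label p True homotopy_class_eq_iff homotopic_is_path by metis
    qed (use trivial p in metis)
  next
    fix r s
    assume p: "is_path K x r x" "is_path K x s x" and "path_label G \<rho> r = path_label G \<rho> s"
    then have "homotopy_class K x r = homotopy_class K x s"
      using bij homotopy_class_in_carrier[OF p(1)] homotopy_class_in_carrier[OF p(2)]
      by (simp add: loop bij_betw_def inj_on_def)
    then show "homotopic K x x r s" using p homotopy_class_eq_iff by metis
  next
    fix g assume "g \<in> carrier G"
    then obtain A where "A \<in> carrier ?F" "g = \<psi> A" using bij by (auto simp: bij_betw_def)
    then show "\<exists>r. is_path K x r x \<and> path_label G \<rho> r = g"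
      by (metis fundamental_group_cases loop)
  qed (rule closed)
qed


text \<open>
  Used for two maps between Squier complexes: surrounding all words by fixed words, and renaming
  letters.
\<close>

lemma homotopic_map:
  assumes verts: "\<And>x. x \<in> verts K \<Longrightarrow> \<phi> x \<in> verts L"
    and edges: "\<And>e. e \<in> edges K \<Longrightarrow> \<epsilon> e \<in> edges L \<and> src L (\<epsilon> e) = \<phi> (src K e) \<and>
      tgt L (\<epsilon> e) = \<phi> (tgt K e) \<and> \<epsilon> (inv_edge K e) = inv_edge L (\<epsilon> e)"
    and cells: "\<And>c. c \<in> cells K \<Longrightarrow> map \<epsilon> c \<in> cells L"
  shows is_path_map: "is_path K x r y \<Longrightarrow> is_path L (\<phi> x) (map \<epsilon> r) (\<phi> y)"
    and "homotopic K x y r s \<Longrightarrow> homotopic L (\<phi> x) (\<phi> y) (map \<epsilon> r) (map \<epsilon> s)"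
proof -
  show path: "is_path K x r y \<Longrightarrow> is_path L (\<phi> x) (map \<epsilon> r) (\<phi> y)" for x r y
    by (induction r arbitrary: x) (use verts edges in auto)
  show "homotopic K x y r s \<Longrightarrow> homotopic L (\<phi> x) (\<phi> y) (map \<epsilon> r) (map \<epsilon> s)"
  proof (induction rule: homotopic.induct)
    case (cancel_edge r e s)
    then have "e \<in> edges K" by (auto simp: is_path_append)
    then have "\<epsilon> (inv_edge K e) = inv_edge L (\<epsilon> e)" using edges by blast
    then show ?case
      using homotopic.cancel_edge[of L "\<phi> x" "map \<epsilon> r" "\<epsilon> e" "map \<epsilon> s" "\<phi> y"]
        path[OF cancel_edge.hyps(1)] path[OF cancel_edge.hyps(2)] by simp
  next
    case (cancel_cell c r s)
    then show ?case
      using homotopic.cancel_cell[OF cells, of c "\<phi> x" "map \<epsilon> r" "map \<epsilon> s" "\<phi> y"]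
        path[OF cancel_cell.hyps(2)] path[OF cancel_cell.hyps(3)] by simp
  qed (auto intro: homotopic.intros path)
qed

text \<open>
  Starting a commuting square at the other end of one of its sides reverses that side and the opposite
  one.
\<close>

lemma (in serre_complex) homotopic_square_rotate:
  assumes "homotopic K x z [e, f'] [f, e']" "is_path K x [e] a" "is_path K x [f] b"
  shows "homotopic K a b [inv_edge K e, f] [f', inv_edge K e']"
proof -
  have p: "is_path K x [e, f'] z" "is_path K x [f, e'] z" using homotopic_is_path assms by metis+
  have q: "is_path K a [f'] z" "is_path K b [e'] z" using p assms by auto
  have i: "is_path K a [inv_edge K e] x" "is_path K z [inv_edge K e'] b"
    using is_path_inv_path[OF assms(2)] is_path_inv_path[OF q(2)] by (auto simp: inv_path_def)
  have "homotopic K a b ([inv_edge K e, f] @ []) ([inv_edge K e, f] @ [e', inv_edge K e'])"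
    using is_path_appendI[OF i(1) assms(3)] homotopic_inv_path_right[OF q(2)]
    by (intro homotopic_appendL) (auto simp: inv_path_def intro: homotopic.sym)
  also have "homotopic K a b ([inv_edge K e, f] @ [e', inv_edge K e'])
     ([inv_edge K e] @ [e, f'] @ [inv_edge K e'])"
    using homotopic_context[OF homotopic.sym[OF assms(1)] i] by simp
  also have "homotopic K a b ([inv_edge K e] @ [e, f'] @ [inv_edge K e']) [f', inv_edge K e']"
    using homotopic_cancel_left[OF assms(2) is_path_appendI[OF q(1) i(2)]]
    by (simp add: inv_path_def)
  finally show ?thesis by simp
qed


section \<open>Squier complexes as strict monoidal groupoids\<close>

lemma squier_complex_simps [simp]:
  "verts (squier_complex P) = nonempty_words (alphabet P)"
  "edges (squier_complex P) = squier_edges P"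
  "src (squier_complex P) = squier_src"
  "tgt (squier_complex P) = squier_tgt"
  "inv_edge (squier_complex P) = squier_inv"
  "cells (squier_complex P) = squier_cells P"
  by (simp_all add: squier_complex_def squier_graph_def)

lemma squier_edge_simps [simp]:
  "squier_src (p, u, v, q) = p @ u @ q"
  "squier_tgt (p, u, v, q) = p @ v @ q"
  "squier_inv (p, u, v, q) = (p, v, u, q)"
  by (simp_all add: squier_src_def squier_tgt_def squier_inv_def)

lemma squier_edges_iff:
  "(p, u, v, q) \<in> squier_edges P \<longleftrightarrow> p \<in> lists (alphabet P) \<and> q \<in> lists (alphabet P) \<and>
    ((u, v) \<in> relations P \<or> (v, u) \<in> relations P)"
  by (auto simp: squier_edges_def)

lemma serre_squier_complex: "serre_complex (squier_complex P)"
  by unfold_locales (auto simp: squier_edges_iff split: prod.splits)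

lemma squier_cellsE:
  assumes "c \<in> squier_cells P"
  obtains p z q l1 r1 l2 r2 where
    "p \<in> lists (alphabet P)" "z \<in> lists (alphabet P)" "q \<in> lists (alphabet P)"
    "(l1, r1) \<in> relations P" "(l2, r2) \<in> relations P"
    "c = [(p, l1, r1, z @ l2 @ q), (p @ r1 @ z, l2, r2, q),
      (p, r1, l1, z @ r2 @ q), (p @ l1 @ z, r2, l2, q)]"
proof -
  from assms obtain p1 p2 p z q l1 r1 l2 r2 where
    "c = p1 @ inv_path (squier_graph P) p2"
    "p1 = [(p, l1, r1, z @ l2 @ q), (p @ r1 @ z, l2, r2, q)]"
    "p2 = [(p @ l1 @ z, l2, r2, q), (p, l1, r1, z @ r2 @ q)]"
    "p \<in> lists (alphabet P)" "z \<in> lists (alphabet P)" "q \<in> lists (alphabet P)"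
    "(l1, r1) \<in> relations P" "(l2, r2) \<in> relations P"
    unfolding squier_cells_def mem_Collect_eq by (elim exE conjE) (rule that; assumption)
  then show thesis by (intro that[of p z q l1 r1 l2 r2]) (auto simp: inv_path_def squier_graph_def)
qed

lemma squier_cellsI:
  assumes "p \<in> lists (alphabet P)" "z \<in> lists (alphabet P)" "q \<in> lists (alphabet P)"
    "(l1, r1) \<in> relations P" "(l2, r2) \<in> relations P"
  shows "[(p, l1, r1, z @ l2 @ q), (p @ r1 @ z, l2, r2, q),
      (p, r1, l1, z @ r2 @ q), (p @ l1 @ z, r2, l2, q)] \<in> squier_cells P"
  unfolding squier_cells_def mem_Collect_eq
  apply (rule exI[of _ "[(p, l1, r1, z @ l2 @ q), (p @ r1 @ z, l2, r2, q)]"],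
      rule exI[of _ "[(p @ l1 @ z, l2, r2, q), (p, l1, r1, z @ r2 @ q)]"],
      rule exI[of _ p], rule exI[of _ z], rule exI[of _ q],
      rule exI[of _ l1], rule exI[of _ r1], rule exI[of _ l2], rule exI[of _ r2])
  using assms by (simp add: inv_path_def squier_graph_def)

definition in_context :: "'a list \<Rightarrow> 'a list \<Rightarrow> 'a edge list \<Rightarrow> 'a edge list" where
  "in_context p q = map (\<lambda>(p', u, v, q'). (p @ p', u, v, q' @ q))"

lemma in_context_simps [simp]:
  "in_context p q [] = []"
  "in_context p q ((p', u, v, q') # r) = (p @ p', u, v, q' @ q) # in_context p q r"
  by (simp_all add: in_context_def)

lemma in_context_append [simp]: "in_context p q (r @ s) = in_context p q r @ in_context p q s"
  by (simp add: in_context_def)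

lemma in_context_in_context [simp]:
  "in_context p q (in_context p' q' r) = in_context (p @ p') (q' @ q) r"
  by (simp add: in_context_def split: prod.splits)

lemma in_context_empty [simp]: "in_context [] [] r = r"
  by (simp add: in_context_def case_prod_unfold)

lemma inv_path_in_context:
  "inv_path (squier_complex P) (in_context p q r) = in_context p q (inv_path (squier_complex P) r)"
  by (auto simp: inv_path_def in_context_def rev_map squier_inv_def)

lemma
  assumes "p \<in> lists (alphabet P)" "q \<in> lists (alphabet P)"
  shows is_path_in_context: "is_path (squier_complex P) x r y \<Longrightarrow>
      is_path (squier_complex P) (p @ x @ q) (in_context p q r) (p @ y @ q)"
    and homotopic_in_context: "homotopic (squier_complex P) x y r s \<Longrightarrow>
      homotopic (squier_complex P) (p @ x @ q) (p @ y @ q) (in_context p q r) (in_context p q s)"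
proof -
  let ?K = "squier_complex P" and ?e = "\<lambda>(p', u, v, q'). (p @ p', u, v, q' @ q)"
  have v: "p @ x @ q \<in> verts ?K" if "x \<in> verts ?K" for x using that assms by auto
  have e: "?e e \<in> edges ?K \<and> src ?K (?e e) = p @ src ?K e @ q \<and>
      tgt ?K (?e e) = p @ tgt ?K e @ q \<and> ?e (inv_edge ?K e) = inv_edge ?K (?e e)"
    if "e \<in> edges ?K" for e
    using that assms by (cases e) (auto simp: squier_edges_iff)
  have c: "map ?e c \<in> cells ?K" if c: "c \<in> cells ?K" for c
    using c[unfolded squier_complex_simps]
  proof (rule squier_cellsE)
    fix p' z q' l1 r1 l2 r2
    assume *: "p' \<in> lists (alphabet P)" "z \<in> lists (alphabet P)"
      "q' \<in> lists (alphabet P)" "(l1, r1) \<in> relations P" "(l2, r2) \<in> relations P"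
      "c = [(p', l1, r1, z @ l2 @ q'), (p' @ r1 @ z, l2, r2, q'),
         (p', r1, l1, z @ r2 @ q'), (p' @ l1 @ z, r2, l2, q')]"
    then show ?thesis
      using squier_cellsI[of "p @ p'" P z "q' @ q", OF _ _ _ *(4,5)] assms by simp
  qed
  show "is_path ?K x r y \<Longrightarrow> is_path ?K (p @ x @ q) (in_context p q r) (p @ y @ q)"
    "homotopic ?K x y r s \<Longrightarrow>
      homotopic ?K (p @ x @ q) (p @ y @ q) (in_context p q r) (in_context p q s)"
    unfolding in_context_def
    by (rule homotopic_map[where \<phi> = "\<lambda>x. p @ x @ q" and \<epsilon> = ?e and K = ?K];
        (assumption | erule v e c))+
qed

definition rename_edges :: "('a \<Rightarrow> 'b) \<Rightarrow> 'a edge list \<Rightarrow> 'b edge list" where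
  "rename_edges f = map (\<lambda>(p, u, v, q). (map f p, map f u, map f v, map f q))"

lemma rename_edges_simps [simp]:
  "rename_edges f [] = []"
  "rename_edges f ((p, u, v, q) # r) = (map f p, map f u, map f v, map f q) # rename_edges f r"
  by (simp_all add: rename_edges_def)

lemma rename_edges_append [simp]: "rename_edges f (r @ s) = rename_edges f r @ rename_edges f s"
  by (simp add: rename_edges_def)

lemma
  fixes f :: "'a \<Rightarrow> 'b"
  assumes "f ` alphabet P \<subseteq> alphabet Q"
    "\<And>u v. (u, v) \<in> relations P \<Longrightarrow> (map f u, map f v) \<in> relations Q"
  shows is_path_rename_edges: "is_path (squier_complex P) x r y \<Longrightarrow>
      is_path (squier_complex Q) (map f x) (rename_edges f r) (map f y)"
    and homotopic_rename_edges: "homotopic (squier_complex P) x y r s \<Longrightarrow>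
      homotopic (squier_complex Q) (map f x) (map f y) (rename_edges f r) (rename_edges f s)"
proof -
  let ?K = "squier_complex P" and ?L = "squier_complex Q"
  let ?e = "\<lambda>(p, u, v, q). (map f p, map f u, map f v, map f q)"
  have l: "map f p \<in> lists (alphabet Q)" if "p \<in> lists (alphabet P)" for p
    using that assms(1) by (auto simp: image_subset_iff)
  have v: "map f x \<in> verts ?L" if "x \<in> verts ?K" for x
    using that l[of x] by (auto simp del: in_lists_conv_set)
  have e: "?e e \<in> edges ?L \<and> src ?L (?e e) = map f (src ?K e) \<and>
      tgt ?L (?e e) = map f (tgt ?K e) \<and> ?e (inv_edge ?K e) = inv_edge ?L (?e e)"
    if "e \<in> edges ?K" for e
    using that assms(2) l by (cases e) (auto simp: squier_edges_iff simp del: in_lists_conv_set)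
  have c: "map ?e c \<in> cells ?L" if c: "c \<in> cells ?K" for c
    using c[unfolded squier_complex_simps]
  proof (rule squier_cellsE)
    fix p z q l1 r1 l2 r2
    assume *: "p \<in> lists (alphabet P)" "z \<in> lists (alphabet P)"
      "q \<in> lists (alphabet P)" "(l1, r1) \<in> relations P" "(l2, r2) \<in> relations P"
      "c = [(p, l1, r1, z @ l2 @ q), (p @ r1 @ z, l2, r2, q),
         (p, r1, l1, z @ r2 @ q), (p @ l1 @ z, r2, l2, q)]"
    show ?thesis
      using squier_cellsI[OF l[OF *(1)] l[OF *(2)] l[OF *(3)] assms(2)[OF *(4)] assms(2)[OF *(5)]]
      by (simp add: *(6))
  qed
  show "is_path ?K x r y \<Longrightarrow> is_path ?L (map f x) (rename_edges f r) (map f y)"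
    "homotopic ?K x y r s \<Longrightarrow>
      homotopic ?L (map f x) (map f y) (rename_edges f r) (rename_edges f s)"
    unfolding rename_edges_def
    by (rule homotopic_map[where \<phi> = "map f" and \<epsilon> = ?e and K = ?K];
        (assumption | erule v e c))+
qed

context
  fixes P :: "'a semigroup_presentation"
  assumes pres: "is_presentation P"
begin

interpretation K: serre_complex "squier_complex P"
  by (rule serre_squier_complex)

lemma is_path_edge:
  assumes "(p, u, v, q) \<in> squier_edges P"
  shows "is_path (squier_complex P) (p @ u @ q) [(p, u, v, q)] (p @ v @ q)"
proof -
  have "u \<in> nonempty_words (alphabet P)" "v \<in> nonempty_words (alphabet P)"
    using assms pres unfolding is_presentation_def squier_edges_iff by blast+
  then show ?thesis using assms by (auto simp: squier_edges_iff)
qed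

lemma interchange_relations:
  assumes "(l1, r1) \<in> relations P" "(l2, r2) \<in> relations P"
    "p1 \<in> lists (alphabet P)" "q1 \<in> lists (alphabet P)"
    "p2 \<in> lists (alphabet P)" "q2 \<in> lists (alphabet P)"
  shows "homotopic (squier_complex P) (p1 @ l1 @ q1 @ p2 @ l2 @ q2) (p1 @ r1 @ q1 @ p2 @ r2 @ q2)
    [(p1, l1, r1, q1 @ p2 @ l2 @ q2), (p1 @ r1 @ q1 @ p2, l2, r2, q2)]
    [(p1 @ l1 @ q1 @ p2, l2, r2, q2), (p1, l1, r1, q1 @ p2 @ r2 @ q2)]"
    (is "homotopic ?K ?x ?y ?r ?s")
proof -
  have w: "l1 \<in> lists (alphabet P)" "r1 \<in> lists (alphabet P)"
    "l2 \<in> lists (alphabet P)" "r2 \<in> lists (alphabet P)"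
    using assms(1,2) pres unfolding is_presentation_def by blast+
  have r: "is_path ?K ?x ?r ?y" and s: "is_path ?K ?x ?s ?y"
    using is_path_appendI[OF is_path_edge[of p1 l1 r1 "q1 @ p2 @ l2 @ q2"]
        is_path_edge[of "p1 @ r1 @ q1 @ p2" l2 r2 q2, simplified append.assoc]]
      is_path_appendI[OF is_path_edge[of "p1 @ l1 @ q1 @ p2" l2 r2 q2, simplified append.assoc]
        is_path_edge[of p1 l1 r1 "q1 @ p2 @ r2 @ q2"]] assms w
    by (auto simp: squier_edges_iff simp del: is_path.simps)
  have "?r @ inv_path ?K ?s \<in> cells ?K"
    using squier_cellsI[of p1 P "q1 @ p2" q2, OF _ _ _ assms(1,2)] assms(3-6)
    by (simp add: inv_path_def)
  moreover have "is_path ?K ?x (?r @ inv_path ?K ?s) ?x"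
    using r K.is_path_inv_path[OF s] by (rule is_path_appendI)
  ultimately have cell: "homotopic ?K ?x ?x (?r @ inv_path ?K ?s) []"
    using homotopic.cancel_cell[of "?r @ inv_path ?K ?s" ?K ?x "[]" "[]" ?x] r
      is_path_verts[OF r] by (simp del: squier_complex_simps)
  have "homotopic ?K ?x ?y (?r @ []) (?r @ inv_path ?K ?s @ ?s)"
    by (intro homotopic_appendL[OF r] homotopic.sym[OF K.homotopic_inv_path_left[OF s]])
  also have "homotopic ?K ?x ?y (?r @ inv_path ?K ?s @ ?s) ([] @ ?s)"
    using homotopic_appendR[OF cell s] by simp
  finally show ?thesis by simp
qed

text \<open>
  The 2-cells only commute relations that are both read from left to right. Rotating these squares
  gives the other orientations.
\<close>

lemma interchange_edges:
  assumes "(p1, u1, v1, q1) \<in> squier_edges P" "(p2, u2, v2, q2) \<in> squier_edges P"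
  shows "homotopic (squier_complex P) (p1 @ u1 @ q1 @ p2 @ u2 @ q2) (p1 @ v1 @ q1 @ p2 @ v2 @ q2)
    [(p1, u1, v1, q1 @ p2 @ u2 @ q2), (p1 @ v1 @ q1 @ p2, u2, v2, q2)]
    [(p1 @ u1 @ q1 @ p2, u2, v2, q2), (p1, u1, v1, q1 @ p2 @ v2 @ q2)]"
proof -
  define sq where "sq u1 v1 u2 v2 \<longleftrightarrow>
    homotopic (squier_complex P) (p1 @ u1 @ q1 @ p2 @ u2 @ q2) (p1 @ v1 @ q1 @ p2 @ v2 @ q2)
    [(p1, u1, v1, q1 @ p2 @ u2 @ q2), (p1 @ v1 @ q1 @ p2, u2, v2, q2)]
    [(p1 @ u1 @ q1 @ p2, u2, v2, q2), (p1, u1, v1, q1 @ p2 @ v2 @ q2)]" for u1 v1 u2 v2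
  have left: "sq v1 u1 u2 v2" if "sq u1 v1 u2 v2" for u1 v1 u2 v2
    using K.homotopic_square_rotate[OF that[unfolded sq_def]]
      homotopic_is_path[OF that[unfolded sq_def]] by (simp add: sq_def)
  have right: "sq u1 v1 v2 u2" if "sq u1 v1 u2 v2" for u1 v1 u2 v2
    using K.homotopic_square_rotate[OF homotopic.sym[OF that[unfolded sq_def]]]
      homotopic_is_path[OF that[unfolded sq_def]] by (simp add: sq_def homotopic.sym)
  have pos: "sq u1 v1 u2 v2" if "(u1, v1) \<in> relations P" "(u2, v2) \<in> relations P" for u1 v1 u2 v2
    using interchange_relations[OF that] assms by (auto simp: sq_def squier_edges_iff)
  have "sq u1 v1 u2 v2" using assms left right pos unfolding squier_edges_iff by metis
  then show ?thesis by (simp only: sq_def)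
qed

text \<open>
  The interchange law of the strict monoidal structure on the fundamental groupoid: the squares of
  \<open>interchange_edges\<close> tile the rectangle whose sides are the two paths.
\<close>

lemma interchange:
  assumes "is_path (squier_complex P) x1 r1 y1" "is_path (squier_complex P) x2 r2 y2"
  shows "homotopic (squier_complex P) (x1 @ x2) (y1 @ y2)
    (in_context [] x2 r1 @ in_context y1 [] r2) (in_context x1 [] r2 @ in_context [] y2 r1)"
proof -
  let ?K = "squier_complex P"
  have word: "x \<in> lists (alphabet P) \<and> y \<in> lists (alphabet P)" if "is_path ?K x r y" for x r y
    using is_path_verts[OF that] by auto
  have L: "is_path ?K (x @ a) (in_context x [] r) (x @ b)"
    if "is_path ?K a r b" "x \<in> lists (alphabet P)" for a r b x
    using is_path_in_context[OF that(2) _ that(1), of "[]"] by simp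
  have R: "is_path ?K (a @ x) (in_context [] x r) (b @ x)"
    if "is_path ?K a r b" "x \<in> lists (alphabet P)" for a r b x
    using is_path_in_context[OF _ that(2,1), of "[]"] by simp
  have edge: "homotopic ?K (x1 @ x2) (y1 @ y2)
      (in_context [] x2 [e] @ in_context y1 [] r2) (in_context x1 [] r2 @ in_context [] y2 [e])"
    if e: "is_path ?K x1 [e] y1" and r2: "is_path ?K x2 r2 y2" for e x1 y1 r2 x2 y2
    using r2
  proof (induction r2 arbitrary: x2)
    case Nil
    then show ?case using R[OF e] word[OF Nil] by (auto intro: homotopic.refl)
  next
    case (Cons f r)
    let ?z = "tgt ?K f"
    have f: "is_path ?K x2 [f] ?z" "is_path ?K ?z r y2"
      using Cons.prems is_path_verts[of ?K ?z r y2] by auto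
    have x1: "x1 \<in> lists (alphabet P)" and y1: "y1 \<in> lists (alphabet P)" using word[OF e] by auto
    obtain p1 u1 v1 q1 p2 u2 v2 q2 where eq: "e = (p1, u1, v1, q1)" "f = (p2, u2, v2, q2)"
      by (meson prod_cases4)
    have "homotopic ?K (x1 @ x2) (y1 @ ?z)
      (in_context [] x2 [e] @ in_context y1 [] [f]) (in_context x1 [] [f] @ in_context [] ?z [e])"
      using interchange_edges[of p1 u1 v1 q1 p2 u2 v2 q2] e f(1) by (auto simp: eq)
    from homotopic_appendR[OF this L[OF f(2) y1]]
    have "homotopic ?K (x1 @ x2) (y1 @ y2) (in_context [] x2 [e] @ in_context y1 [] (f # r))
        (in_context x1 [] [f] @ in_context [] ?z [e] @ in_context y1 [] r)"
      by (simp add: eq)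
    also have "homotopic ?K (x1 @ x2) (y1 @ y2)
        (in_context x1 [] [f] @ in_context [] ?z [e] @ in_context y1 [] r)
        (in_context x1 [] [f] @ in_context x1 [] r @ in_context [] y2 [e])"
      by (intro homotopic_appendL[OF L[OF f(1) x1]] Cons.IH f)
    finally show ?case by (simp add: eq)
  qed
  show ?thesis using assms(1)
  proof (induction r1 arbitrary: x1)
    case Nil
    then show ?case using L[OF assms(2)] word[OF Nil] by (auto intro: homotopic.refl)
  next
    case (Cons e r)
    let ?z = "tgt ?K e"
    have e: "is_path ?K x1 [e] ?z" "is_path ?K ?z r y1"
      using Cons.prems is_path_verts[of ?K ?z r y1] by auto
    have x2: "x2 \<in> lists (alphabet P)" and y2: "y2 \<in> lists (alphabet P)"
      using word[OF assms(2)] by auto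
    obtain p u v q where eq: "e = (p, u, v, q)" by (meson prod_cases4)
    have "homotopic ?K (x1 @ x2) (y1 @ y2)
        (in_context [] x2 [e] @ in_context [] x2 r @ in_context y1 [] r2)
        (in_context [] x2 [e] @ in_context ?z [] r2 @ in_context [] y2 r)"
      by (intro homotopic_appendL[OF R[OF e(1) x2]] Cons.IH e)
    also have "homotopic ?K (x1 @ x2) (y1 @ y2)
        (in_context [] x2 [e] @ in_context ?z [] r2 @ in_context [] y2 r)
        (in_context x1 [] r2 @ in_context [] y2 [e] @ in_context [] y2 r)"
      using homotopic_appendR[OF edge[OF e(1) assms(2)] R[OF e(2) y2]] by simp
    finally show ?case by (simp add: eq)
  qed
qed

end


section \<open>Recognising wreath products with the integers\<close>

lemma wreath_Z_carrier:
  assumes "group G"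
  shows "(f, n) \<in> carrier (wreath_Z G) \<longleftrightarrow>
    (\<forall>i. f i \<in> carrier G) \<and> finite {i. f i \<noteq> \<one>\<^bsub>G\<^esub>}"
  using assms
  by (simp add: wreath_Z_def semidirect_product_def carrier_sum_group PiE_UNIV_domain Pi_iff)

lemma wreath_Z_mult:
  "(f, m) \<otimes>\<^bsub>wreath_Z G\<^esub> (g, n) = (\<lambda>i. f i \<otimes>\<^bsub>G\<^esub> g (i - m), m + n)"
  by (simp add: wreath_Z_def semidirect_product_def shift_def restrict_UNIV)

lemma wreath_Z_one: "\<one>\<^bsub>wreath_Z G\<^esub> = (\<lambda>_. \<one>\<^bsub>G\<^esub>, 0)"
  by (simp add: wreath_Z_def semidirect_product_def restrict_UNIV)

lemma finite_int_shift:
  fixes m :: int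
  shows "finite {i. P i} \<Longrightarrow> finite {i. P (i + m)}"
proof -
  assume "finite {i. P i}"
  then have "finite ((\<lambda>i. i - m) ` {i. P i})" by simp
  also have "(\<lambda>i. i - m) ` {i. P i} = {i. P (i + m)}" by (force simp: image_iff)
  finally show ?thesis .
qed

lemma group_wreath_Z:
  assumes G: "group G"
  shows "group (wreath_Z G)"
proof -
  interpret group G by fact
  show ?thesis
  proof (rule groupI)
    fix x y z
    assume "x \<in> carrier (wreath_Z G)" "y \<in> carrier (wreath_Z G)"
    then obtain f m g n where xy: "x = (f, m)" "y = (g, n)"
      "\<And>i. f i \<in> carrier G" "finite {i. f i \<noteq> \<one>\<^bsub>G\<^esub>}"
      "\<And>i. g i \<in> carrier G" "finite {i. g i \<noteq> \<one>\<^bsub>G\<^esub>}"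
      by (cases x; cases y) (simp add: wreath_Z_carrier G)
    have "finite ({i. f i \<noteq> \<one>\<^bsub>G\<^esub>} \<union> {i. g (i - m) \<noteq> \<one>\<^bsub>G\<^esub>})"
      using xy finite_int_shift[of "\<lambda>i. g i \<noteq> \<one>\<^bsub>G\<^esub>" "- m"] by simp
    moreover have "{i. f i \<otimes>\<^bsub>G\<^esub> g (i - m) \<noteq> \<one>\<^bsub>G\<^esub>} \<subseteq> {i. f i \<noteq> \<one>\<^bsub>G\<^esub>} \<union> {i. g (i - m) \<noteq> \<one>\<^bsub>G\<^esub>}" by auto
    ultimately have "finite {i. f i \<otimes>\<^bsub>G\<^esub> g (i - m) \<noteq> \<one>\<^bsub>G\<^esub>}" by (rule rev_finite_subset)
    then show "x \<otimes>\<^bsub>wreath_Z G\<^esub> y \<in> carrier (wreath_Z G)"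
      using xy by (simp add: wreath_Z_mult wreath_Z_carrier G)
    assume "z \<in> carrier (wreath_Z G)"
    then obtain h k where "z = (h, k)" "\<And>i. h i \<in> carrier G"
      by (cases z) (simp add: wreath_Z_carrier G)
    with xy show "x \<otimes>\<^bsub>wreath_Z G\<^esub> y \<otimes>\<^bsub>wreath_Z G\<^esub> z = x \<otimes>\<^bsub>wreath_Z G\<^esub> (y \<otimes>\<^bsub>wreath_Z G\<^esub> z)"
      by (simp add: wreath_Z_mult m_assoc algebra_simps)
  next
    fix x assume "x \<in> carrier (wreath_Z G)"
    then obtain f m where x: "x = (f, m)" "\<And>i. f i \<in> carrier G" "finite {i. f i \<noteq> \<one>\<^bsub>G\<^esub>}"
      by (cases x) (simp add: wreath_Z_carrier G)
    then show "\<one>\<^bsub>wreath_Z G\<^esub> \<otimes>\<^bsub>wreath_Z G\<^esub> x = x" by (simp add: wreath_Z_one wreath_Z_mult)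
    have "{i. inv\<^bsub>G\<^esub> (f (i + m)) \<noteq> \<one>\<^bsub>G\<^esub>} = {i. f (i + m) \<noteq> \<one>\<^bsub>G\<^esub>}" using x(2) by (simp add: inv_eq_1_iff)
    then have "(\<lambda>i. inv\<^bsub>G\<^esub> (f (i + m)), - m) \<in> carrier (wreath_Z G)"
      using x finite_int_shift[of "\<lambda>i. f i \<noteq> \<one>\<^bsub>G\<^esub>" m] by (simp add: wreath_Z_carrier G)
    moreover have "(\<lambda>i. inv\<^bsub>G\<^esub> (f (i + m)), - m) \<otimes>\<^bsub>wreath_Z G\<^esub> x = \<one>\<^bsub>wreath_Z G\<^esub>"
      using x(2) by (simp add: x(1) wreath_Z_mult wreath_Z_one)
    ultimately show "\<exists>y\<in>carrier (wreath_Z G). y \<otimes>\<^bsub>wreath_Z G\<^esub> x = \<one>\<^bsub>wreath_Z G\<^esub>" by blast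
  qed (simp_all add: wreath_Z_one wreath_Z_carrier G)
qed

definition wreath_base :: "('g, 'm) monoid_scheme \<Rightarrow> int \<Rightarrow> 'g \<Rightarrow> (int \<Rightarrow> 'g) \<times> int" where
  "wreath_base G i g = (\<lambda>j. if j = i then g else \<one>\<^bsub>G\<^esub>, 0)"

definition wreath_shift :: "('g, 'm) monoid_scheme \<Rightarrow> int \<Rightarrow> (int \<Rightarrow> 'g) \<times> int" where
  "wreath_shift G n = (\<lambda>_. \<one>\<^bsub>G\<^esub>, n)"

context
  fixes G :: "('g, 'm) monoid_scheme"
  assumes G: "group G"
begin

interpretation group G by (rule G)
interpretation W: group "wreath_Z G" by (rule group_wreath_Z[OF G])

lemma wreath_base_closed [simp]:
  "g \<in> carrier G \<Longrightarrow> wreath_base G i g \<in> carrier (wreath_Z G)"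
  by (simp add: wreath_base_def wreath_Z_carrier G)

lemma wreath_shift_closed [simp]: "wreath_shift G n \<in> carrier (wreath_Z G)"
  by (simp add: wreath_shift_def wreath_Z_carrier G)

lemma wreath_shift_mult [simp]:
  "wreath_shift G m \<otimes>\<^bsub>wreath_Z G\<^esub> wreath_shift G n = wreath_shift G (m + n)"
  by (simp add: wreath_shift_def wreath_Z_mult)

lemma wreath_shift_0: "wreath_shift G 0 = \<one>\<^bsub>wreath_Z G\<^esub>"
  by (simp add: wreath_shift_def wreath_Z_one)

lemma wreath_base_one: "wreath_base G i \<one>\<^bsub>G\<^esub> = \<one>\<^bsub>wreath_Z G\<^esub>"
  by (simp add: wreath_base_def wreath_Z_one)

lemma inv_wreath_shift: "inv\<^bsub>wreath_Z G\<^esub> (wreath_shift G n) = wreath_shift G (- n)"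
  by (rule W.inv_equality) (simp_all add: wreath_shift_0)

lemma wreath_shift_pow: "wreath_shift G 1 [^]\<^bsub>wreath_Z G\<^esub> (n::int) = wreath_shift G n"
proof -
  have nat: "wreath_shift G 1 [^]\<^bsub>wreath_Z G\<^esub> (n::nat) = wreath_shift G (int n)" for n
    by (induction n) (simp_all add: wreath_shift_0 add.commute)
  show ?thesis by (simp add: int_pow_def2 nat inv_wreath_shift)
qed

lemma wreath_base_mult:
  "g \<in> carrier G \<Longrightarrow> h \<in> carrier G \<Longrightarrow>
    wreath_base G i g \<otimes>\<^bsub>wreath_Z G\<^esub> wreath_base G i h = wreath_base G i (g \<otimes>\<^bsub>G\<^esub> h)"
  by (auto simp: wreath_base_def wreath_Z_mult)

lemma wreath_base_commute:
  "g \<in> carrier G \<Longrightarrow> h \<in> carrier G \<Longrightarrow> i \<noteq> j \<Longrightarrow>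
    wreath_base G i g \<otimes>\<^bsub>wreath_Z G\<^esub> wreath_base G j h =
    wreath_base G j h \<otimes>\<^bsub>wreath_Z G\<^esub> wreath_base G i g"
  by (auto simp: wreath_base_def wreath_Z_mult)

lemma wreath_shift_base:
  "g \<in> carrier G \<Longrightarrow>
    wreath_shift G n \<otimes>\<^bsub>wreath_Z G\<^esub> wreath_base G i g =
    wreath_base G (i + n) g \<otimes>\<^bsub>wreath_Z G\<^esub> wreath_shift G n"
  by (auto simp: wreath_base_def wreath_shift_def wreath_Z_mult algebra_simps)

text \<open>
  The hypotheses on T and \<open>\<tau>\<close> bring every element of K into the form of a product of conjugates of
  elements of \<open>\<tau> ` carrier G\<close> by different powers of T, followed by a power of T: a further factor
  \<open>\<tau> g\<close> passes the power of T on its left at the cost of a conjugation and then commutes with all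
  conjugates of other exponents until it meets its own. The homomorphism \<open>\<Phi>\<close> reads off the factors, so
  it is injective. The factors form a list because G need not be commutative.
\<close>

lemma wreath_Z_recognition:
  fixes K :: "('k, 'n) monoid_scheme"
  assumes K: "group K" and \<Phi>: "\<Phi> \<in> hom K (wreath_Z G)"
    and T: "T \<in> carrier K" and \<tau>: "\<tau> \<in> hom G K"
    and \<Phi>_T: "\<Phi> T = wreath_shift G 1"
    and \<Phi>_\<tau>: "\<And>g. g \<in> carrier G \<Longrightarrow> \<Phi> (\<tau> g) = wreath_base G 0 g"
    and gen: "carrier K \<subseteq> generate K (insert T (\<tau> ` carrier G))"
    and comm: "\<And>g h n. g \<in> carrier G \<Longrightarrow> h \<in> carrier G \<Longrightarrow> n > 0 \<Longrightarrow>
      \<tau> g \<otimes>\<^bsub>K\<^esub> (T [^]\<^bsub>K\<^esub> n \<otimes>\<^bsub>K\<^esub> \<tau> h \<otimes>\<^bsub>K\<^esub> inv\<^bsub>K\<^esub> (T [^]\<^bsub>K\<^esub> n)) =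
      T [^]\<^bsub>K\<^esub> (n::nat) \<otimes>\<^bsub>K\<^esub> \<tau> h \<otimes>\<^bsub>K\<^esub> inv\<^bsub>K\<^esub> (T [^]\<^bsub>K\<^esub> n) \<otimes>\<^bsub>K\<^esub> \<tau> g"
  shows "\<Phi> \<in> iso K (wreath_Z G)"
proof -
  interpret K: group K by fact
  interpret \<Phi>: group_hom K "wreath_Z G" \<Phi> by unfold_locales (rule \<Phi>)
  interpret \<tau>: group_hom G K \<tau> by unfold_locales (rule \<tau>)
  define conj where "conj i g = T [^]\<^bsub>K\<^esub> i \<otimes>\<^bsub>K\<^esub> \<tau> g \<otimes>\<^bsub>K\<^esub> inv\<^bsub>K\<^esub> (T [^]\<^bsub>K\<^esub> i)" for i :: int and g
  have conj_closed [simp]: "conj i g \<in> carrier K" if "g \<in> carrier G" for i g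
    using that T by (simp add: conj_def)
  have conj_T: "conj i g \<otimes>\<^bsub>K\<^esub> T [^]\<^bsub>K\<^esub> i = T [^]\<^bsub>K\<^esub> i \<otimes>\<^bsub>K\<^esub> \<tau> g" if "g \<in> carrier G" for i g
    using that T by (simp add: conj_def K.m_assoc)
  have conj_mult: "conj i (g \<otimes>\<^bsub>G\<^esub> h) = conj i g \<otimes>\<^bsub>K\<^esub> conj i h"
    if "g \<in> carrier G" "h \<in> carrier G" for i g h
    using that T by (simp add: conj_def K.m_assoc K.inv_solve_left K.inv_solve_right'
        flip: K.m_assoc[of "inv\<^bsub>K\<^esub> (T [^]\<^bsub>K\<^esub> i)"])
  have conj_add: "conj (i + j) g = T [^]\<^bsub>K\<^esub> i \<otimes>\<^bsub>K\<^esub> conj j g \<otimes>\<^bsub>K\<^esub> inv\<^bsub>K\<^esub> (T [^]\<^bsub>K\<^esub> i)"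
    if "g \<in> carrier G" for i j g
    using that T by (simp add: conj_def K.int_pow_mult K.inv_mult_group K.m_assoc)
  have comm_less: "conj i g \<otimes>\<^bsub>K\<^esub> conj j h = conj j h \<otimes>\<^bsub>K\<^esub> conj i g"
    if "i < j" "g \<in> carrier G" "h \<in> carrier G" for i j g h
  proof -
    have conj_of: "T [^]\<^bsub>K\<^esub> i \<otimes>\<^bsub>K\<^esub> a \<otimes>\<^bsub>K\<^esub> inv\<^bsub>K\<^esub> (T [^]\<^bsub>K\<^esub> i) \<otimes>\<^bsub>K\<^esub> (T [^]\<^bsub>K\<^esub> i \<otimes>\<^bsub>K\<^esub> b \<otimes>\<^bsub>K\<^esub> inv\<^bsub>K\<^esub> (T [^]\<^bsub>K\<^esub> i)) =
        T [^]\<^bsub>K\<^esub> i \<otimes>\<^bsub>K\<^esub> (a \<otimes>\<^bsub>K\<^esub> b) \<otimes>\<^bsub>K\<^esub> inv\<^bsub>K\<^esub> (T [^]\<^bsub>K\<^esub> i)"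
      if "a \<in> carrier K" "b \<in> carrier K" for a b
      using that T by (simp add: K.m_assoc flip: K.m_assoc[of "inv\<^bsub>K\<^esub> (T [^]\<^bsub>K\<^esub> i)"])
    have "\<tau> g \<otimes>\<^bsub>K\<^esub> conj (j - i) h = conj (j - i) h \<otimes>\<^bsub>K\<^esub> \<tau> g"
      using comm[OF that(2,3), of "nat (j - i)"] that(1)
        int_pow_int[of K T "nat (j - i)"] by (simp add: conj_def)
    moreover have "conj i g = T [^]\<^bsub>K\<^esub> i \<otimes>\<^bsub>K\<^esub> \<tau> g \<otimes>\<^bsub>K\<^esub> inv\<^bsub>K\<^esub> (T [^]\<^bsub>K\<^esub> i)" by (simp add: conj_def)
    moreover have "conj j h = T [^]\<^bsub>K\<^esub> i \<otimes>\<^bsub>K\<^esub> conj (j - i) h \<otimes>\<^bsub>K\<^esub> inv\<^bsub>K\<^esub> (T [^]\<^bsub>K\<^esub> i)"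
      using conj_add[OF that(3), of i "j - i"] by simp
    ultimately show ?thesis using conj_of that by simp
  qed
  have conj_comm: "conj i g \<otimes>\<^bsub>K\<^esub> conj j h = conj j h \<otimes>\<^bsub>K\<^esub> conj i g"
    if "i \<noteq> j" "g \<in> carrier G" "h \<in> carrier G" for i j g h
    using that comm_less[of i j g h] comm_less[of j i h g] by (cases "i < j") auto
  define pr where "pr f l = path_label K (\<lambda>i. conj i (f i)) l" for f l
  have pr_simps [simp]: "pr f [] = \<one>\<^bsub>K\<^esub>" "pr f (i # l) = conj i (f i) \<otimes>\<^bsub>K\<^esub> pr f l" for f i l
    by (simp_all add: pr_def)
  have pr_closed [simp]: "pr f l \<in> carrier K" if "\<And>i. f i \<in> carrier G" for f l
    using that by (induction l) auto
  have pr_append: "pr f (l @ l') = pr f l \<otimes>\<^bsub>K\<^esub> pr f l'" if "\<And>i. f i \<in> carrier G" for f l l'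
    using that by (simp add: pr_def K.path_label_append)
  have pr_upd: "pr (f(n := g)) l = pr f l" if "n \<notin> set l" for f n g l
    using that by (induction l) auto
  have pr_comm: "pr f l \<otimes>\<^bsub>K\<^esub> conj n g = conj n g \<otimes>\<^bsub>K\<^esub> pr f l"
    if "\<And>i. f i \<in> carrier G" "g \<in> carrier G" "n \<notin> set l" for f n g l
    using that(3)
  proof (induction l)
    case (Cons i l)
    have "pr f (i # l) \<otimes>\<^bsub>K\<^esub> conj n g = conj i (f i) \<otimes>\<^bsub>K\<^esub> (conj n g \<otimes>\<^bsub>K\<^esub> pr f l)"
      using Cons that(1,2) by (simp add: K.m_assoc)
    also have "\<dots> = conj n g \<otimes>\<^bsub>K\<^esub> conj i (f i) \<otimes>\<^bsub>K\<^esub> pr f l"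
      using Cons that(1,2) conj_comm[of i n "f i" g] by (simp flip: K.m_assoc)
    finally show ?case using that(1,2) by (simp add: K.m_assoc)
  qed (use that in simp)
  have pr_mult: "pr f l \<otimes>\<^bsub>K\<^esub> conj n g = pr (f(n := f n \<otimes>\<^bsub>G\<^esub> g)) l"
    if "\<And>i. f i \<in> carrier G" "g \<in> carrier G" "n \<in> set l" "distinct l" for f n g l
    using that(3,4)
  proof (induction l)
    case (Cons i l)
    show ?case
    proof (cases "i = n")
      case True
      then have "pr f l \<otimes>\<^bsub>K\<^esub> conj n g = conj n g \<otimes>\<^bsub>K\<^esub> pr f l" using Cons.prems that pr_comm by simp
      then have "pr f (i # l) \<otimes>\<^bsub>K\<^esub> conj n g = conj n (f n) \<otimes>\<^bsub>K\<^esub> conj n g \<otimes>\<^bsub>K\<^esub> pr f l"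
        using True that(1,2) by (simp add: K.m_assoc)
      moreover have n: "n \<notin> set l" using True Cons.prems by simp
      have "pr (f(n := f n \<otimes>\<^bsub>G\<^esub> g)) (i # l) = conj n (f n \<otimes>\<^bsub>G\<^esub> g) \<otimes>\<^bsub>K\<^esub> pr f l"
        using True by (simp only: pr_simps fun_upd_same pr_upd[OF n])
      ultimately show ?thesis using that(1,2) by (simp only: conj_mult)
    next
      case False
      then show ?thesis using Cons that(1,2) by (simp add: K.m_assoc)
    qed
  qed simp
  define nf where "nf x \<longleftrightarrow> (\<exists>f l n. (\<forall>i. f i \<in> carrier G) \<and> distinct l \<and>
    x = pr f l \<otimes>\<^bsub>K\<^esub> T [^]\<^bsub>K\<^esub> (n::int))" for x
  have normal_form: "nf x" if x: "x \<in> carrier K" for x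
  proof -
    have nfI: "nf (pr f l \<otimes>\<^bsub>K\<^esub> T [^]\<^bsub>K\<^esub> (n::int))" if "\<And>i. f i \<in> carrier G" "distinct l" for f l n
      using that unfolding nf_def by blast
    have nf_closed: "y \<in> carrier K" if "nf y" for y using that T unfolding nf_def by auto
    have nf_\<tau>: "nf (y \<otimes>\<^bsub>K\<^esub> \<tau> g)" if "nf y" "g \<in> carrier G" for y g
    proof -
      obtain f l n where y: "\<And>i. f i \<in> carrier G" "distinct l" "y = pr f l \<otimes>\<^bsub>K\<^esub> T [^]\<^bsub>K\<^esub> (n::int)"
        using \<open>nf y\<close> unfolding nf_def by blast
      have eq: "y \<otimes>\<^bsub>K\<^esub> \<tau> g = pr f l \<otimes>\<^bsub>K\<^esub> conj n g \<otimes>\<^bsub>K\<^esub> T [^]\<^bsub>K\<^esub> n"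
        using y(1) that(2) T by (simp add: y(3) K.m_assoc conj_T)
      show ?thesis
      proof (cases "n \<in> set l")
        case True
        show ?thesis unfolding eq pr_mult[OF y(1) that(2) True y(2)]
          by (rule nfI) (use y(1,2) that(2) in auto)
      next
        case False
        then have "pr f l \<otimes>\<^bsub>K\<^esub> conj n g = pr (f(n := g)) (l @ [n])"
          using pr_append[of "f(n := g)" l "[n]"] pr_upd[OF False, of f g] y(1) that(2) by simp
        then show ?thesis unfolding eq
          by (simp only:) (rule nfI, use y(1,2) that(2) False in auto)
      qed
    qed
    have nf_T: "nf (y \<otimes>\<^bsub>K\<^esub> T [^]\<^bsub>K\<^esub> (m::int))" if "nf y" for y m
    proof -
      obtain f l n where y: "\<And>i. f i \<in> carrier G" "distinct l" "y = pr f l \<otimes>\<^bsub>K\<^esub> T [^]\<^bsub>K\<^esub> (n::int)"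
        using \<open>nf y\<close> unfolding nf_def by blast
      have "y \<otimes>\<^bsub>K\<^esub> T [^]\<^bsub>K\<^esub> m = pr f l \<otimes>\<^bsub>K\<^esub> T [^]\<^bsub>K\<^esub> (n + m)"
        using y(1) T by (simp add: y(3) K.m_assoc K.int_pow_mult)
      then show ?thesis using nfI[OF y(1,2)] by simp
    qed
    have "nf (y \<otimes>\<^bsub>K\<^esub> x)" if "x \<in> generate K (insert T (\<tau> ` carrier G))" "nf y" for x y
      using that
    proof (induction arbitrary: y rule: generate.induct)
      case one
      then have "y \<in> carrier K" by (rule nf_closed)
      with one show ?case by simp
    next
      case (incl h)
      then show ?case using nf_T[of y 1] nf_\<tau> T by auto
    next
      case (inv h)
      then show ?case using nf_T[of y "-1"] nf_\<tau>[of y "inv\<^bsub>G\<^esub> g" for g] T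
        by (auto simp: K.int_pow_neg simp flip: \<tau>.hom_inv)
    next
      case (eng h1 h2)
      have sub: "insert T (\<tau> ` carrier G) \<subseteq> carrier K" using T by auto
      have "h1 \<in> carrier K" "h2 \<in> carrier K" "y \<in> carrier K"
        using K.generate_in_carrier[OF sub] eng.hyps nf_closed[OF eng.prems] by blast+
      then have "y \<otimes>\<^bsub>K\<^esub> (h1 \<otimes>\<^bsub>K\<^esub> h2) = y \<otimes>\<^bsub>K\<^esub> h1 \<otimes>\<^bsub>K\<^esub> h2" by (simp add: K.m_assoc)
      then show ?case using eng.IH(2)[OF eng.IH(1)[OF eng.prems]] by simp
    qed
    moreover have "nf \<one>\<^bsub>K\<^esub>"
      using nfI[of "\<lambda>_. \<one>\<^bsub>G\<^esub>" "[]" 0] by simp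
    ultimately have "nf (\<one>\<^bsub>K\<^esub> \<otimes>\<^bsub>K\<^esub> x)" using x gen by blast
    then show ?thesis using x by simp
  qed
  have \<Phi>_pow: "\<Phi> (T [^]\<^bsub>K\<^esub> (n::int)) = wreath_shift G n" for n
    using T by (simp add: \<Phi>.hom_int_pow \<Phi>_T wreath_shift_pow)
  have \<Phi>_conj: "\<Phi> (conj i g) = wreath_base G i g" if "g \<in> carrier G" for i g
    using that T wreath_shift_base[of g i 0]
    by (simp add: conj_def \<Phi>_pow \<Phi>_\<tau> inv_wreath_shift W.m_assoc wreath_shift_0)
  have \<Phi>_pr: "\<Phi> (pr f l) = (\<lambda>i. if i \<in> set l then f i else \<one>\<^bsub>G\<^esub>, 0)"
    if "\<And>i. f i \<in> carrier G" "distinct l" for f l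
    using that(2)
  proof (induction l)
    case Nil
    then show ?case by (simp add: wreath_Z_one)
  next
    case (Cons i l)
    then show ?case using that(1) by (auto simp: \<Phi>_conj wreath_base_def wreath_Z_mult)
  qed
  have \<Phi>_nf: "\<Phi> (pr f l \<otimes>\<^bsub>K\<^esub> T [^]\<^bsub>K\<^esub> (n::int)) = (\<lambda>i. if i \<in> set l then f i else \<one>\<^bsub>G\<^esub>, n)"
    if "\<And>i. f i \<in> carrier G" "distinct l" for f l n
    using that T by (auto simp: \<Phi>_pr \<Phi>_pow wreath_shift_def wreath_Z_mult)
  have "x = \<one>\<^bsub>K\<^esub>" if "x \<in> carrier K" "\<Phi> x = \<one>\<^bsub>wreath_Z G\<^esub>" for x
  proof -
    have "nf x" by (rule normal_form[OF that(1)])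
    then obtain f l n where x: "\<And>i. f i \<in> carrier G" "distinct l" "x = pr f l \<otimes>\<^bsub>K\<^esub> T [^]\<^bsub>K\<^esub> (n::int)"
      unfolding nf_def by blast
    have nf: "(\<lambda>i. if i \<in> set l then f i else \<one>\<^bsub>G\<^esub>) = (\<lambda>_. \<one>\<^bsub>G\<^esub>)" "n = 0"
      using that(2) \<Phi>_nf[where n = n, OF x(1,2)] by (simp_all add: x(3) wreath_Z_one)
    have "f i = \<one>\<^bsub>G\<^esub>" if "i \<in> set l" for i using fun_cong[OF nf(1), of i] that by simp
    then have "pr f l = \<one>\<^bsub>K\<^esub>" by (induction l) (auto simp: conj_def T)
    then show ?thesis by (simp add: x(3) nf(2))
  qed
  then have "inj_on \<Phi> (carrier K)" using \<Phi>.inj_on_one_iff by blast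
  moreover have "\<Phi> ` carrier K = carrier (wreath_Z G)"
  proof
    show "carrier (wreath_Z G) \<subseteq> \<Phi> ` carrier K"
    proof
      fix x assume "x \<in> carrier (wreath_Z G)"
      then obtain f n where x: "x = (f, n)" "\<And>i. f i \<in> carrier G" "finite {i. f i \<noteq> \<one>\<^bsub>G\<^esub>}"
        by (cases x) (simp add: wreath_Z_carrier G)
      let ?l = "sorted_list_of_set {i. f i \<noteq> \<one>\<^bsub>G\<^esub>}"
      have "x = \<Phi> (pr f ?l \<otimes>\<^bsub>K\<^esub> T [^]\<^bsub>K\<^esub> n)" using x by (auto simp: \<Phi>_nf)
      then show "x \<in> \<Phi> ` carrier K" using x(2) T by (metis imageI K.int_pow_closed K.m_closed pr_closed)
    qed
  qed auto
  ultimately show ?thesis using \<Phi> by (simp add: iso_def bij_betw_def)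
qed

end


section \<open>The presentation of the wreath product\<close>

text \<open>
  The letters a, s, t and c of the introduction are \<open>lend\<close>, \<open>lbr\<close>, \<open>rbr\<close> and \<open>rend\<close>, the left and
  right end markers and brackets.
\<close>

abbreviation lend :: "'a + nat" where "lend \<equiv> Inr 0"
abbreviation lbr :: "'a + nat" where "lbr \<equiv> Inr 1"
abbreviation rbr :: "'a + nat" where "rbr \<equiv> Inr 2"
abbreviation rend :: "'a + nat" where "rend \<equiv> Inr 3"

definition block :: "'a list \<Rightarrow> ('a + nat) list" where
  "block u = lbr # map Inl u @ [rbr]"

definition blocks :: "'a list list \<Rightarrow> ('a + nat) list" where
  "blocks us = concat (map block us) @ [rend]"

lemma blocks_simps: "blocks [] = [rend]" "blocks (u # us) = block u @ blocks us"
  by (simp_all add: blocks_def)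

definition wreath_presentation ::
  "'a semigroup_presentation \<Rightarrow> 'a list \<Rightarrow> ('a + nat) semigroup_presentation" where
  "wreath_presentation P w =
    \<lparr>alphabet = Inl ` alphabet P \<union> {lend, lbr, rbr, rend},
     relations = {(map Inl u, map Inl v) | u v. (u, v) \<in> relations P} \<union>
       {(lend # block w, [lend]), (block w @ [rend], [rend])}\<rparr>"

lemma wreath_relation_cases:
  assumes "(u, v) \<in> relations (wreath_presentation P w)"
  obtains (inner) u' v' where "(u', v') \<in> relations P" "u = map Inl u'" "v = map Inl v'"
  | (left) "u = lend # block w" "v = [lend]"
  | (right) "u = block w @ [rend]" "v = [rend]"
  using assms by (auto simp: wreath_presentation_def)

lemma Inl_list_Inr_eq:
  "map Inl x @ Inr k # y = map Inl x' @ Inr k' # y' \<longleftrightarrow> x = x' \<and> k = k' \<and> y = y'"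
proof (induction x arbitrary: x')
  case Nil
  then show ?case by (cases x') auto
next
  case (Cons a x)
  then show ?case by (cases x') auto
qed

text \<open>
  In a word with separators, the next two lemmas locate a factor: it lies either inside the run of letters
  of P before the first separator or beyond that separator.
\<close>

lemma Inr_factor:
  assumes "map Inl x @ Inr k # y = p @ Inr j # q" "j \<noteq> k"
  obtains p' where "p = map Inl x @ Inr k # p'" "y = p' @ Inr j # q"
proof -
  have "\<exists>p'. p = map Inl x @ Inr k # p' \<and> y = p' @ Inr j # q"
    using assms
  proof (induction x arbitrary: p)
    case Nil
    then show ?case by (cases p) auto
  next
    case (Cons a x)
    then show ?case by (cases p) auto
  qed
  then show thesis using that by blast
qed

lemma Inl_factor:
  assumes "map Inl x @ Inr k # y = p @ map Inl u @ q" "u \<noteq> []"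
  obtains (inside) x1 x2 where "x = x1 @ u @ x2" "p = map Inl x1" "q = map Inl x2 @ Inr k # y"
  | (beyond) p' where "p = map Inl x @ Inr k # p'" "y = p' @ map Inl u @ q"
proof -
  have prefix: "\<exists>x2. x = u @ x2 \<and> q = map Inl x2 @ Inr k # y"
    if "map Inl x @ Inr k # y = map Inl u @ q" for x u q
    using that
  proof (induction u arbitrary: x)
    case (Cons a u)
    then show ?case by (cases x) auto
  qed simp
  have "(\<exists>x1 x2. x = x1 @ u @ x2 \<and> p = map Inl x1 \<and> q = map Inl x2 @ Inr k # y) \<or>
      (\<exists>p'. p = map Inl x @ Inr k # p' \<and> y = p' @ map Inl u @ q)"
    using assms(1)
  proof (induction x arbitrary: p)
    case Nil
    then show ?case using assms(2) by (cases p; cases u) auto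
  next
    case (Cons a x)
    show ?case
    proof (cases p)
      case Nil
      then show ?thesis using prefix[of "a # x" u q] Cons.prems by auto
    next
      case (Cons b p')
      with Cons.IH[of p'] Cons.prems show ?thesis
        by (auto intro: exI[of _ "b # x1" for b x1])
    qed
  qed
  then show thesis using that by blast
qed

lemma rend_in_blocks: "p @ rend # q = blocks us \<Longrightarrow> q = []"
proof (induction us arbitrary: p)
  case Nil
  then show ?case by (cases p) (auto simp: blocks_simps)
next
  case (Cons u us)
  then obtain p' where p': "p = lbr # p'" "map Inl u @ rbr # blocks us = p' @ rend # q"
    by (cases p) (auto simp: blocks_simps block_def)
  then obtain p'' where "blocks us = p'' @ rend # q" by (auto elim: Inr_factor)
  then show ?case using Cons.IH by metis
qed

lemma lend_notin_blocks: "lend \<notin> set (blocks us)"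
  by (induction us) (auto simp: blocks_simps block_def)

text \<open>
  A separator that follows letters of P directly is a closing bracket. Therefore two factors over P
  that are not in the same block have a closing bracket between them, and their blocks have different
  positions.
\<close>

lemma after_inner_in_blocks:
  assumes "p @ map Inl u @ map Inl x @ Inr k # q = blocks us" "u \<noteq> []"
  shows "Inr k = (rbr :: 'a + nat)"
  using assms(1)
proof (induction us arbitrary: p)
  case Nil
  then show ?case using assms(2) by (cases p; cases u) (auto simp: blocks_simps)
next
  case (Cons u' us)
  then obtain p' where "p = lbr # p'" and
    eq: "map Inl u' @ rbr # blocks us = p' @ map Inl u @ map Inl x @ Inr k # q"
    using assms(2) by (cases p; cases u) (auto simp: blocks_simps block_def)
  from eq assms(2) show ?case
  proof (cases rule: Inl_factor)
    case (inside x1 x2)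
    then show ?thesis by (simp add: Inl_list_Inr_eq)
  next
    case (beyond p'')
    then show ?thesis using Cons.IH by metis
  qed
qed

definition add_block :: "'a list \<Rightarrow> ('a + nat) edge list" where
  "add_block w = [([], [rend], block w @ [rend], [])]"

definition absorb_block :: "'a list \<Rightarrow> ('a + nat) edge list" where
  "absorb_block w = [([], lend # block w, [lend], [])]"

definition in_block :: "'a edge list \<Rightarrow> ('a + nat) edge list" where
  "in_block g = in_context [lbr] [rbr] (rename_edges Inl g)"

lemma in_block_append [simp]: "in_block (g @ h) = in_block g @ in_block h"
  by (simp add: in_block_def)

lemma in_block_Nil [simp]: "in_block [] = []"
  by (simp add: in_block_def)

locale wreath_setup =
  fixes P :: "'a semigroup_presentation" and w :: "'a list"
  assumes pres: "is_presentation P" and w: "w \<in> nonempty_words (alphabet P)"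
begin

abbreviation "Q \<equiv> wreath_presentation P w"
abbreviation "K \<equiv> squier_complex Q"

lemma presQ: "is_presentation Q"
proof -
  have 1: "(map Inl u :: ('a + nat) list) \<noteq> lend # x" "(map Inl u :: ('a + nat) list) \<noteq> [rend]"
    "(map Inl u :: ('a + nat) list) \<noteq> block v @ x" for u :: "'a list" and v x
    by (cases u; simp add: block_def)+
  have inj: "map Inl u = (map Inl v :: ('a + nat) list) \<longleftrightarrow> u = v" for u v :: "'a list"
    by (simp add: inj_map_eq_map)
  have rel: "u \<noteq> [] \<and> v \<noteq> [] \<and> set u \<subseteq> alphabet P \<and> set v \<subseteq> alphabet P \<and> (v, u) \<notin> relations P"
    if "(u, v) \<in> relations P" for u v
    using that pres unfolding is_presentation_def by blast
  have "relations Q \<subseteq> nonempty_words (alphabet Q) \<times> nonempty_words (alphabet Q)"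
  proof (rule subrelI)
    fix u v assume "(u, v) \<in> relations Q"
    then show "(u, v) \<in> nonempty_words (alphabet Q) \<times> nonempty_words (alphabet Q)"
      by (cases rule: wreath_relation_cases)
        (use w in \<open>auto simp: wreath_presentation_def block_def intro!: imageI dest!: rel\<close>)
  qed
  moreover have "(v, u) \<notin> relations Q" if "(u, v) \<in> relations Q" for u v
  proof
    assume "(v, u) \<in> relations Q"
    with that show False
      by (elim wreath_relation_cases) (auto simp: block_def inj 1 1[symmetric] dest: rel)
  qed
  ultimately show ?thesis by (simp add: is_presentation_def)
qed

sublocale K: serre_complex K by (rule serre_squier_complex)

lemma lists_Q:
  "u \<in> lists (alphabet P) \<Longrightarrow> map Inl u \<in> lists (alphabet Q)"
  "lend \<in> alphabet Q" "lbr \<in> alphabet Q" "rbr \<in> alphabet Q" "rend \<in> alphabet Q"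
  by (auto simp: wreath_presentation_def)

lemma block_w_lists [simp]: "block w \<in> lists (alphabet Q)"
  using w lists_Q by (auto simp: block_def)

lemma path_left: "is_path K (x @ a) (in_context x [] r) (x @ b)"
  if "is_path K a r b" "x \<in> lists (alphabet Q)" for a r b x
  using is_path_in_context[OF that(2) _ that(1), of "[]"] by simp

lemma path_right: "is_path K (a @ x) (in_context [] x r) (b @ x)"
  if "is_path K a r b" "x \<in> lists (alphabet Q)" for a r b x
  using is_path_in_context[OF _ that(2,1), of "[]"] by simp

lemma homotopic_left: "homotopic K (x @ a) (x @ b) (in_context x [] r) (in_context x [] s)"
  if "homotopic K a b r s" "x \<in> lists (alphabet Q)" for a r b x
  using homotopic_in_context[OF that(2) _ that(1), of "[]"] by simp

lemma path_word:
  assumes "is_path K x r y" shows "x \<in> lists (alphabet Q)" "y \<in> lists (alphabet Q)"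
  using is_path_verts[OF assms] by auto

lemma add_block_path: "is_path K [rend] (add_block w) (block w @ [rend])"
  using is_path_edge[OF presQ, of "[]" "[rend]" "block w @ [rend]" "[]"]
  by (simp add: add_block_def squier_edges_iff wreath_presentation_def)

lemma absorb_block_path: "is_path K (lend # block w) (absorb_block w) [lend]"
  using is_path_edge[OF presQ, of "[]" "lend # block w" "[lend]" "[]"]
  by (simp add: absorb_block_def squier_edges_iff wreath_presentation_def)

lemma in_block_path:
  assumes "is_path (squier_complex P) u g v"
  shows "is_path K (block u) (in_block g) (block v)"
proof -
  have "is_path K (map Inl u) (rename_edges Inl g) (map Inl v)"
    by (rule is_path_rename_edges[OF _ _ assms]) (auto simp: wreath_presentation_def)
  then show ?thesis
    unfolding in_block_def block_def
    using is_path_in_context[of "[lbr]" Q "[rbr]"] lists_Q by fastforce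
qed

lemma in_block_homotopic:
  assumes "homotopic (squier_complex P) u v g h"
  shows "homotopic K (block u) (block v) (in_block g) (in_block h)"
proof -
  have "homotopic K (map Inl u) (map Inl v) (rename_edges Inl g) (rename_edges Inl h)"
    by (rule homotopic_rename_edges[OF _ _ assms]) (auto simp: wreath_presentation_def)
  then show ?thesis
    unfolding in_block_def block_def
    using homotopic_in_context[of "[lbr]" Q "[rbr]"] lists_Q by fastforce
qed

text \<open>
  Paths from c to the word of the blocks without its left end marker. Leaving that marker off makes
  the definition recursive in the list of blocks, as the blocks after the first one are themselves
  created from the letter c. The paths inside the blocks are arbitrary, so that a rewriting step in a
  block can simply be appended to the path of that block.
\<close>

inductive canonical :: "'a list list \<Rightarrow> ('a + nat) edge list \<Rightarrow> bool" where
  Nil: "canonical [] []"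
| Cons: "is_path (squier_complex P) w g u \<Longrightarrow> canonical us r \<Longrightarrow>
    canonical (u # us) (add_block w @ in_context [] [rend] (in_block g) @ in_context (block u) [] r)"

text \<open>
  The loop at c that creates blocks number 0 to k, runs g in the last of them and deletes them again.
\<close>

fun loop_at :: "nat \<Rightarrow> 'a edge list \<Rightarrow> ('a + nat) edge list" where
  "loop_at 0 g = add_block w @ in_context [] [rend] (in_block g) @ inv_path K (add_block w)"
| "loop_at (Suc k) g =
    add_block w @ in_context (block w) [] (loop_at k g) @ inv_path K (add_block w)"

lemma canonical_path: "canonical us r \<Longrightarrow> is_path K [rend] r (blocks us)"
proof (induction rule: canonical.induct)
  case Nil
  then show ?case by (simp add: blocks_simps wreath_presentation_def)
next
  case (Cons g u us r)
  have g: "is_path K (block w @ [rend]) (in_context [] [rend] (in_block g)) (block u @ [rend])"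
    using path_right[OF in_block_path[OF Cons(1)], of "[rend]"] lists_Q by simp
  have "is_path K (block u @ [rend]) (in_context (block u) [] r) (block u @ blocks us)"
    using path_left[OF Cons(3)] path_word[OF in_block_path[OF Cons(1)]] by simp
  then show ?case
    unfolding blocks_simps by (intro is_path_appendI[OF add_block_path] is_path_appendI[OF g])
qed

lemma loop_at_path: "is_path (squier_complex P) w g w \<Longrightarrow> is_path K [rend] (loop_at k g) [rend]"
proof (induction k)
  case 0
  have p: "is_path K (block w @ [rend]) (in_context [] [rend] (in_block g)) (block w @ [rend])"
    using path_right[OF in_block_path[OF 0], of "[rend]"] lists_Q by simp
  show ?case
    unfolding loop_at.simps
    by (rule is_path_appendI[OF add_block_path
          is_path_appendI[OF p K.is_path_inv_path[OF add_block_path]]])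
next
  case (Suc k)
  have p: "is_path K (block w @ [rend]) (in_context (block w) [] (loop_at k g)) (block w @ [rend])"
    using path_left[OF Suc.IH[OF Suc.prems]] by simp
  show ?case
    unfolding loop_at.simps
    by (rule is_path_appendI[OF add_block_path
          is_path_appendI[OF p K.is_path_inv_path[OF add_block_path]]])
qed

lemma edge_context:
  assumes "(a @ p, u, v, q) \<in> squier_edges Q" 
  shows "(p, u, v, q) \<in> squier_edges Q"
  using assms by (auto simp: squier_edges_iff)

text \<open>
  Steps right of the left end marker. A step inside block i commutes with the creation of the later
  blocks and is absorbed into the path of block i, and the creation of a block extends the path. If
  the last block, number k, is deleted, the path in it is a loop g at w. By the interchange law the
  loop that creates the block, runs g and deletes it moves in front of the paths of the earlier
  blocks, where it turns into \<open>loop_at k g\<close>.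
\<close>

lemma canonical_step:
  assumes "canonical us r" "(p, u, v, q) \<in> squier_edges Q" "p @ u @ q = blocks us"
  shows "\<exists>us' r' d. canonical us' r' \<and> p @ v @ q = blocks us' \<and>
    (d = [] \<or> (\<exists>k g. is_path (squier_complex P) w g w \<and> d = loop_at k g)) \<and>
    homotopic K [rend] (blocks us') (r @ [(p, u, v, q)]) (d @ r')"
  using assms
proof (induction arbitrary: p rule: canonical.induct)
  case Nil
  have "u \<noteq> []" using Nil(1) presQ by (auto simp: squier_edges_iff is_presentation_def)
  then have eq: "p = []" "u = [rend]" "q = []"
    using Nil(2) by (auto simp: blocks_simps append_eq_Cons_conv)
  have "(u, v) \<in> relations Q \<or> (v, u) \<in> relations Q" using Nil(1) by (simp add: squier_edges_iff)
  then have v: "v = block w @ [rend]"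
    unfolding eq by (auto elim!: wreath_relation_cases simp: block_def)
  have "canonical [w] (add_block w)"
    using canonical.Cons[OF _ canonical.Nil, of "[]" w] w by simp
  moreover have "homotopic K [rend] (block w @ [rend]) (add_block w) (add_block w)"
    by (rule homotopic.refl[OF add_block_path])
  ultimately show ?case
    by (intro exI[of _ "[w]"] exI[of _ "add_block w"] exI[of _ "[]"])
      (simp add: eq v add_block_def blocks_simps)
next
  case (Cons g x us r)
  let ?r = "add_block w @ in_context [] [rend] (in_block g) @ in_context (block x) [] r"
  let ?good = "\<lambda>us' r' d. canonical us' r' \<and> p @ v @ q = blocks us' \<and>
    (d = [] \<or> (\<exists>k g. is_path (squier_complex P) w g w \<and> d = loop_at k g)) \<and>
    homotopic K [rend] (blocks us') (?r @ [(p, u, v, q)]) (d @ r')"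
  have xw: "block x \<in> lists (alphabet Q)" "rend \<in> alphabet Q"
    using path_word[OF in_block_path[OF Cons(1)]] lists_Q by auto
  have rp: "is_path K [rend] r (blocks us)" by (rule canonical_path[OF Cons(2)])
  have gp: "is_path K (block w @ [rend]) (in_context [] [rend] (in_block g)) (block x @ [rend])"
    using path_right[OF in_block_path[OF Cons(1)], of "[rend]"] lists_Q by simp
  have ap: "is_path K [rend] (add_block w @ in_context [] [rend] (in_block g)) (block x @ [rend])"
    by (rule is_path_appendI[OF add_block_path gp])
  have e: "(u, v) \<in> relations Q \<or> (v, u) \<in> relations Q" using Cons.prems by (simp add: squier_edges_iff)
  have eq: "lbr # map Inl x @ rbr # blocks us = p @ u @ q"
    using Cons.prems(2) by (simp add: blocks_simps block_def)
  have beyond_case: ?case if p: "p = block x @ p'" "p' @ u @ q = blocks us" for p'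
  proof -
    have e': "(p', u, v, q) \<in> squier_edges Q" using Cons.prems(1) edge_context unfolding p by blast
    from Cons.IH[OF e' p(2)] obtain us' r' d where IH: "canonical us' r'" "p' @ v @ q = blocks us'"
      "d = [] \<or> (\<exists>k g. is_path (squier_complex P) w g w \<and> d = loop_at k g)"
      "homotopic K [rend] (blocks us') (r @ [(p', u, v, q)]) (d @ r')" by blast
    let ?r' = "add_block w @ in_context [] [rend] (in_block g) @ in_context (block x) [] r'"
    have can: "canonical (x # us') ?r'" by (rule canonical.Cons[OF Cons(1) IH(1)])
    have tgt: "p @ v @ q = blocks (x # us')" using IH(2) p by (simp add: blocks_simps)
    have r'p: "is_path K (block x @ [rend]) (in_context (block x) [] r') (blocks (x # us'))"
      unfolding blocks_simps by (rule path_left[OF canonical_path[OF IH(1)] xw(1)])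
    have "homotopic K (block x @ [rend]) (blocks (x # us'))
        (in_context (block x) [] (r @ [(p', u, v, q)])) (in_context (block x) [] (d @ r'))"
      unfolding blocks_simps by (rule homotopic_left[OF IH(4) xw(1)])
    from homotopic_appendL[OF ap this]
    have hom: "homotopic K [rend] (blocks (x # us')) (?r @ [(p, u, v, q)])
        (add_block w @ in_context [] [rend] (in_block g) @ in_context (block x) [] d @ in_context (block x) [] r')"
      by (simp add: p)
    from IH(3) show ?thesis
    proof
      assume "d = []"
      then have "?good (x # us') ?r' []" using can tgt hom by simp
      then show ?thesis by blast
    next
      assume "\<exists>k g. is_path (squier_complex P) w g w \<and> d = loop_at k g"
      then obtain k h where h: "is_path (squier_complex P) w h w" "d = loop_at k h" by blast
      have dp: "is_path K [rend] d [rend]" using h loop_at_path by simp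
      have bdp: "is_path K (block w @ [rend]) (in_context (block w) [] d) (block w @ [rend])"
        by (rule path_left[OF dp block_w_lists])
      \<comment> \<open>The loop d to the right of block x commutes with the path g that turned w into x, so it
        may be run before g. Deleting and recreating the block then splits off the loop.\<close>
      note hom
      also have "homotopic K [rend] (blocks (x # us'))
          (add_block w @ (in_context [] [rend] (in_block g) @ in_context (block x) [] d) @ in_context (block x) [] r')
          (add_block w @ (in_context (block w) [] d @ in_context [] [rend] (in_block g)) @ in_context (block x) [] r')"
        by (rule homotopic_context[OF interchange[OF presQ in_block_path[OF Cons(1)] dp] add_block_path r'p])
      then have "homotopic K [rend] (blocks (x # us'))
          (add_block w @ in_context [] [rend] (in_block g) @ in_context (block x) [] d @ in_context (block x) [] r')
          ((add_block w @ in_context (block w) [] d) @ [] @ in_context [] [rend] (in_block g) @ in_context (block x) [] r')"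
        by simp
      also have "homotopic K [rend] (blocks (x # us'))
          ((add_block w @ in_context (block w) [] d) @ [] @ in_context [] [rend] (in_block g) @ in_context (block x) [] r')
          ((add_block w @ in_context (block w) [] d) @ (inv_path K (add_block w) @ add_block w) @
            in_context [] [rend] (in_block g) @ in_context (block x) [] r')"
        by (rule homotopic_context[OF homotopic.sym[OF K.homotopic_inv_path_left[OF add_block_path]]
              is_path_appendI[OF add_block_path bdp] is_path_appendI[OF gp r'p]])
      finally have "homotopic K [rend] (blocks (x # us')) (?r @ [(p, u, v, q)])
          (loop_at (Suc k) h @ ?r')" by (simp add: h(2))
      with can tgt h(1) show ?thesis by blast
    qed
  qed
  have inner_case: ?case if uv: "u = map Inl u'" "v = map Inl v'" "(u', v') \<in> relations P \<or> (v', u') \<in> relations P"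
    for u' v'
  proof -
    have u': "u' \<noteq> []" using uv(3) pres by (auto simp: is_presentation_def)
    with eq uv(1) obtain p' where p: "p = lbr # p'" "map Inl x @ rbr # blocks us = p' @ map Inl u' @ q"
      by (cases p; cases u') auto
    from p(2) u' show ?thesis
    proof (cases rule: Inl_factor)
      case (beyond p'')
      with p uv show ?thesis by (intro beyond_case[of p'']) (auto simp: block_def)
    next
        case (inside x1 x2)
      let ?f = "(x1, u', v', x2)" and ?y = "x1 @ v' @ x2"
      have "is_path (squier_complex P) w g x" by (rule Cons(1))
      then have "x \<in> lists (alphabet P)" using is_path_verts by fastforce
      then have "?f \<in> squier_edges P" using uv(3) inside(1) by (auto simp: squier_edges_iff)
      then have fp: "is_path (squier_complex P) x [?f] ?y"
        using is_path_edge[OF pres] inside(1) by simp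
      have gf: "is_path (squier_complex P) w (g @ [?f]) ?y" by (rule is_path_appendI[OF Cons(1) fp])
      let ?r' = "add_block w @ in_context [] [rend] (in_block (g @ [?f])) @ in_context (block ?y) [] r"
      have can: "canonical (?y # us) ?r'" by (rule canonical.Cons[OF gf Cons(2)])
      have edge: "[(p, u, v, q)] = in_context [] (blocks us) (in_block [?f])"
        using p inside uv by (simp add: in_block_def)
      have tgt: "p @ v @ q = blocks (?y # us)"
        using p inside uv by (simp add: blocks_simps block_def)
      have "homotopic K [rend] (blocks (?y # us))
          ((add_block w @ in_context [] [rend] (in_block g)) @
            in_context (block x) [] r @ in_context [] (blocks us) (in_block [?f]))
          ((add_block w @ in_context [] [rend] (in_block g)) @
            in_context [] [rend] (in_block [?f]) @ in_context (block ?y) [] r)"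
        unfolding blocks_simps
        by (rule homotopic_appendL[OF ap homotopic.sym[OF interchange[OF presQ in_block_path[OF fp] rp]]])
      then have "?good (?y # us) ?r' []" using can tgt edge by simp
      then show ?thesis by blast
    qed
  qed
  have right_case: ?case if uv: "u = block w @ [rend]" "v = [rend]"
  proof -
    have "q = []" using rend_in_blocks[of "p @ block w" q "x # us"] Cons.prems(2) uv by simp
    show ?thesis
    proof (cases p)
      case Nil
      with eq uv have "map Inl x @ rbr # blocks us = map Inl w @ rbr # rend # q"
        by (simp add: block_def)
      then have "x = w" "blocks us = [rend]" using \<open>q = []\<close> by (simp_all add: Inl_list_Inr_eq)
      then have "us = []" by (cases us) (auto simp: blocks_simps block_def)
      then have "r = []" using Cons(2) by (auto elim: canonical.cases)
      have g: "is_path (squier_complex P) w g w" using Cons(1) \<open>x = w\<close> by simp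
      have "?r @ [(p, u, v, q)] = loop_at 0 g"
        using \<open>x = w\<close> \<open>r = []\<close> \<open>q = []\<close> Nil uv by (simp add: add_block_def inv_path_def)
      moreover have "p @ v @ q = blocks []" using Nil uv \<open>q = []\<close> by (simp add: blocks_simps)
      moreover have "homotopic K [rend] (blocks []) (loop_at 0 g) (loop_at 0 g @ [])"
        using homotopic.refl[OF loop_at_path[OF g]] by (simp add: blocks_simps del: loop_at.simps)
      ultimately show ?thesis using canonical.Nil g by metis
    next
      case (Cons b p')
      with eq uv(1) have "map Inl x @ rbr # blocks us = p' @ lbr # map Inl w @ rbr # rend # q"
        and b: "b = lbr" by (auto simp: block_def)
      from this(1) obtain p'' where
        "p' = map Inl x @ rbr # p''" "blocks us = p'' @ lbr # map Inl w @ rbr # rend # q"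
        by (rule Inr_factor) auto
      with Cons b uv(1) show ?thesis by (intro beyond_case[of p'']) (auto simp: block_def)
    qed
  qed
  have add_case: ?case if uv: "u = [rend]" "v = block w @ [rend]"
  proof (cases p)
    case Nil
    with eq uv show ?thesis by simp
  next
    case (Cons b p')
    with eq uv(1) have "map Inl x @ rbr # blocks us = p' @ rend # q" and b: "b = lbr" by auto
    from this(1) obtain p'' where "p' = map Inl x @ rbr # p''" "blocks us = p'' @ rend # q"
      by (rule Inr_factor) auto
    with Cons b uv(1) show ?thesis by (intro beyond_case[of p'']) (auto simp: block_def)
  qed
  have no_lend: "lend \<notin> set u" using lend_notin_blocks[of "x # us"] Cons.prems(2) 
    by (metis Un_iff set_append)
  from e show ?case
  proof
    assume "(u, v) \<in> relations Q"
    then show ?case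
    proof (cases rule: wreath_relation_cases)
      case (inner u' v')
      then show ?thesis by (intro inner_case) auto
    next
      case left
      then show ?thesis using no_lend by simp
    next
      case right
      then show ?thesis by (rule right_case)
    qed
  next
    assume "(v, u) \<in> relations Q"
    then show ?case
    proof (cases rule: wreath_relation_cases)
      case (inner v' u')
      then show ?thesis by (intro inner_case) auto
    next
      case left
      then show ?thesis using no_lend by simp
    next
      case right
      then show ?thesis by (intro add_case)
    qed
  qed
qed

section \<open>Generators of the fundamental group\<close>

abbreviation "base \<equiv> [lend, rend] :: ('a + nat) list"

abbreviation "F \<equiv> fundamental_group K base"

definition shift_loop :: "('a + nat) edge list" where
  "shift_loop = in_context [lend] [] (add_block w) @ in_context [] [rend] (absorb_block w)"

definition wreath_generators :: "('a + nat) edge list set set" where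
  "wreath_generators = insert (homotopy_class K base shift_loop)
    {homotopy_class K base (in_context [lend] [] (loop_at 0 g)) | g. is_path (squier_complex P) w g w}"

lemma add_path: "is_path K base (in_context [lend] [] (add_block w)) (lend # block w @ [rend])"
  using path_left[OF add_block_path, of "[lend]"] lists_Q by simp

lemma absorb_path: "is_path K (lend # block w @ [rend]) (in_context [] [rend] (absorb_block w)) base"
  using path_right[OF absorb_block_path, of "[rend]"] lists_Q by simp

lemma shift_loop_path: "is_path K base shift_loop base"
  unfolding shift_loop_def by (rule is_path_appendI[OF add_path absorb_path])

lemma base_loop_path:
  "is_path K [rend] d [rend] \<Longrightarrow> is_path K base (in_context [lend] [] d) base"
  using path_left[of "[rend]" d "[rend]" "[lend]"] lists_Q by simp

lemma base_vert: "base \<in> verts K"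
  using lists_Q by simp

lemma group_F: "group F"
  by (rule K.group_fundamental_group[OF base_vert])

text \<open>
  The loop d commutes with the absorption of a block into the left end marker, which therefore cancels
  against its inverse.
\<close>

lemma shift_loop_conjugate:
  assumes "is_path K [rend] d [rend]"
  shows "homotopic K base base
    (shift_loop @ in_context [lend] [] d @ inv_path K shift_loop)
    (in_context [lend] [] (add_block w @ in_context (block w) [] d @ inv_path K (add_block w)))"
proof -
  let ?i = "in_context [lend] [] (add_block w)" and ?l = "in_context [] [rend] (absorb_block w)"
  note dp = base_loop_path[OF assms]
  have bd: "is_path K (lend # block w @ [rend]) (in_context (lend # block w) [] d) (lend # block w @ [rend])"
    using path_left[OF assms, of "lend # block w"] lists_Q(2) block_w_lists by simp
  note ip = add_path and lp = absorb_path
  have "homotopic K (lend # block w @ [rend]) base (?l @ in_context [lend] [] d)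
      (in_context (lend # block w) [] d @ ?l)"
    using interchange[OF presQ absorb_block_path assms] by simp
  from homotopic_context[OF this ip is_path_appendI[OF K.is_path_inv_path[OF lp] K.is_path_inv_path[OF ip]]]
  have "homotopic K base base (?i @ (?l @ in_context [lend] [] d) @ inv_path K ?l @ inv_path K ?i)
      ((?i @ in_context (lend # block w) [] d) @ (?l @ inv_path K ?l) @ inv_path K ?i)" by simp
  also have "homotopic K base base
      ((?i @ in_context (lend # block w) [] d) @ (?l @ inv_path K ?l) @ inv_path K ?i)
      ((?i @ in_context (lend # block w) [] d) @ [] @ inv_path K ?i)"
    by (rule homotopic_context[OF K.homotopic_inv_path_right[OF lp] is_path_appendI[OF ip bd]
          K.is_path_inv_path[OF ip]])
  finally show ?thesis
    by (simp add: shift_loop_def inv_path_append inv_path_in_context)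
qed

lemma loop_at_conjugate:
  assumes "is_path (squier_complex P) w g w"
  shows "homotopy_class K base (in_context [lend] [] (loop_at k g)) =
    homotopy_class K base shift_loop [^]\<^bsub>F\<^esub> k \<otimes>\<^bsub>F\<^esub>
    homotopy_class K base (in_context [lend] [] (loop_at 0 g)) \<otimes>\<^bsub>F\<^esub>
    inv\<^bsub>F\<^esub> (homotopy_class K base shift_loop [^]\<^bsub>F\<^esub> k)"
proof -
  interpret F: group F by (rule group_F)
  let ?T = "homotopy_class K base shift_loop"
  let ?L = "\<lambda>k. homotopy_class K base (in_context [lend] [] (loop_at k g))"
  have T: "?T \<in> carrier F" by (rule homotopy_class_in_carrier[OF shift_loop_path])
  have L: "is_path K base (in_context [lend] [] (loop_at k g)) base" for k
    by (rule base_loop_path[OF loop_at_path[OF assms]])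
  note Lc = homotopy_class_in_carrier[OF L]
  have Suc: "?L (Suc k) = ?T \<otimes>\<^bsub>F\<^esub> ?L k \<otimes>\<^bsub>F\<^esub> inv\<^bsub>F\<^esub> ?T" for k
  proof -
    note p = shift_loop_path L[of k] K.is_path_inv_path[OF shift_loop_path]
    have "?T \<otimes>\<^bsub>F\<^esub> ?L k \<otimes>\<^bsub>F\<^esub> inv\<^bsub>F\<^esub> ?T = homotopy_class K base
        ((shift_loop @ in_context [lend] [] (loop_at k g)) @ inv_path K shift_loop)"
      by (simp only: K.inv_homotopy_class[OF p(1)] mult_homotopy_class[OF p(1,2)]
          mult_homotopy_class[OF is_path_appendI[OF p(1,2)] p(3)])
    also have "\<dots> = ?L (Suc k)"
      using shift_loop_conjugate[OF loop_at_path[OF assms, of k]] L[of "Suc k"]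
        homotopy_class_eq_iff[OF is_path_appendI[OF is_path_appendI[OF p(1,2)] p(3)]] by simp
    finally show ?thesis by simp
  qed
  show ?thesis
  proof (induction k)
    case 0
    then show ?case using Lc[of 0] by simp
  next
    case (Suc k)
    have comm: "?T [^]\<^bsub>F\<^esub> Suc k = ?T \<otimes>\<^bsub>F\<^esub> ?T [^]\<^bsub>F\<^esub> k" by (rule F.nat_pow_Suc2[OF T])
    show ?case
      unfolding \<open>?L (Suc k) = _\<close> Suc comm using T Lc[of 0] by (simp add: F.m_assoc F.inv_mult_group)
  qed
qed

text \<open>
  After cancellation of a deleted and recreated block, both products create one block, run g in it and
  the other loop to its right, and delete it.
\<close>

lemma loop_at_commute:
  assumes g: "is_path (squier_complex P) w g w" and h: "is_path (squier_complex P) w h w"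
  shows "homotopic K [rend] [rend] (loop_at 0 g @ loop_at (Suc k) h) (loop_at (Suc k) h @ loop_at 0 g)"
proof -
  let ?i = "add_block w" and ?b = "block w @ [rend]"
  let ?g = "in_context [] [rend] (in_block g)" and ?h = "in_context (block w) [] (loop_at k h)"
  note ip = add_block_path and jp = K.is_path_inv_path[OF add_block_path]
  have gp: "is_path K ?b ?g ?b"
    using path_right[OF in_block_path[OF g], of "[rend]"] lists_Q by simp
  have hp: "is_path K ?b ?h ?b"
    by (rule path_left[OF loop_at_path[OF h] block_w_lists])
  have cancel: "homotopic K [rend] [rend] ((?i @ a) @ (inv_path K ?i @ ?i) @ (b @ inv_path K ?i))
      ((?i @ a) @ [] @ (b @ inv_path K ?i))"
    if "is_path K ?b a ?b" "is_path K ?b b ?b" for a b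
    by (rule homotopic_context[OF K.homotopic_inv_path_left[OF ip]
          is_path_appendI[OF ip that(1)] is_path_appendI[OF that(2) jp]])
  have "homotopic K [rend] [rend] (loop_at 0 g @ loop_at (Suc k) h) (?i @ (?g @ ?h) @ inv_path K ?i)"
    using cancel[OF gp hp] by simp
  also have "homotopic K [rend] [rend] (?i @ (?g @ ?h) @ inv_path K ?i) (?i @ (?h @ ?g) @ inv_path K ?i)"
    by (rule homotopic_context[OF interchange[OF presQ in_block_path[OF g] loop_at_path[OF h]] ip jp])
  also have "homotopic K [rend] [rend] (?i @ (?h @ ?g) @ inv_path K ?i) (loop_at (Suc k) h @ loop_at 0 g)"
    using homotopic.sym[OF cancel[OF hp gp]] by simp
  finally show ?thesis .
qed

definition generated_loop :: "('a + nat) edge list \<Rightarrow> bool" where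
  "generated_loop h \<longleftrightarrow> is_path K base h base \<and> homotopy_class K base h \<in> generate F wreath_generators"

lemma generated_loop_append:
  "generated_loop h \<Longrightarrow> generated_loop h' \<Longrightarrow> generated_loop (h @ h')"
  unfolding generated_loop_def
  by (auto simp: is_path_appendI simp flip: mult_homotopy_class intro: generate.eng)

lemma wreath_generators_closed: "wreath_generators \<subseteq> carrier F"
  unfolding wreath_generators_def
  using homotopy_class_in_carrier[OF shift_loop_path]
    homotopy_class_in_carrier[OF base_loop_path[OF loop_at_path]] by blast

lemma generated_shift_loop: "generated_loop shift_loop" "generated_loop (inv_path K shift_loop)"
proof -
  have T: "homotopy_class K base shift_loop \<in> wreath_generators" by (simp add: wreath_generators_def)
  show "generated_loop shift_loop"
    using generate.incl[OF T] shift_loop_path by (simp add: generated_loop_def)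
  show "generated_loop (inv_path K shift_loop)"
    using generate.inv[OF T, of F] K.is_path_inv_path[OF shift_loop_path]
    by (simp add: generated_loop_def K.inv_homotopy_class[OF shift_loop_path])
qed

lemma generated_loop_at:
  assumes "is_path (squier_complex P) w g w"
  shows "generated_loop (in_context [lend] [] (loop_at k g))"
proof -
  interpret F: group F by (rule group_F)
  interpret S: subgroup "generate F wreath_generators" F
    by (rule F.generate_is_subgroup[OF wreath_generators_closed])
  have T: "homotopy_class K base shift_loop \<in> generate F wreath_generators"
    using generated_shift_loop by (simp add: generated_loop_def)
  have "homotopy_class K base shift_loop [^]\<^bsub>F\<^esub> k \<in> generate F wreath_generators"
    by (induction k) (auto intro: T)
  moreover have "homotopy_class K base (in_context [lend] [] (loop_at 0 g)) \<in> generate F wreath_generators"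
    using assms unfolding wreath_generators_def by (blast intro: generate.incl)
  ultimately have "homotopy_class K base (in_context [lend] [] (loop_at k g)) \<in> generate F wreath_generators"
    unfolding loop_at_conjugate[OF assms, of k] by blast
  then show ?thesis using base_loop_path[OF loop_at_path[OF assms]] by (simp add: generated_loop_def)
qed

text \<open>
  Besides \<open>canonical_step\<close> this has to treat the steps at the left end marker. An absorption there
  commutes with everything to the right of the first block. The remaining path creates the block,
  runs a loop g at w in it, and absorbs it; inserting a deletion and a new creation splits it into the
  loop of g and \<open>shift_loop\<close>. The reverse step is \<open>shift_loop\<close> reversed, followed by the creation of
  a block at the right end.
\<close>

lemma path_normal_form:
  assumes "is_path K base r y"
  shows "\<exists>us r' h. y = lend # blocks us \<and> canonical us r' \<and> generated_loop h \<and>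
    homotopic K base y r (h @ in_context [lend] [] r')"
  using assms
proof (induction r arbitrary: y rule: rev_induct)
  case Nil
  have "is_path K base [] base" using base_vert by (simp del: squier_complex_simps)
  moreover from this have "generated_loop []"
    by (simp add: generated_loop_def generate.one flip: one_fundamental_group del: is_path.simps)
  ultimately show ?case using Nil canonical.Nil homotopic.refl[of K base "[]" base]
    by (intro exI[of _ "[]"] exI[of _ "[]"] exI[of _ "[]"]) (auto simp: blocks_simps)
next
  case (snoc e r)
  then obtain x where x: "is_path K base r x" "is_path K x [e] y" by (auto simp: is_path_append simp del: is_path.simps)
  from snoc.IH[OF x(1)] obtain us r0 h where IH: "x = lend # blocks us" "canonical us r0" "generated_loop h"
    "homotopic K base x r (h @ in_context [lend] [] r0)" by blast
  obtain p u v q where e: "e = (p, u, v, q)" by (meson prod_cases4)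
  have edge: "(p, u, v, q) \<in> squier_edges Q" and src: "p @ u @ q = lend # blocks us" and y: "y = p @ v @ q"
    using x(2) IH(1) by (auto simp: e)
  have re: "homotopic K base y (r @ [e]) (h @ in_context [lend] [] r0 @ [e])"
    using homotopic_appendR[OF IH(4) x(2)] by simp
  have hp: "is_path K base h base" using IH(3) by (simp add: generated_loop_def)
  have r0: "is_path K [rend] r0 (blocks us)" by (rule canonical_path[OF IH(2)])
  have l: "[lend] \<in> lists (alphabet Q)" using lists_Q by simp
  show ?case
  proof (cases p)
    case (Cons b p')
    then have p: "p = [lend] @ p'" and src': "p' @ u @ q = blocks us" using src by auto
    have e': "(p', u, v, q) \<in> squier_edges Q" using edge edge_context unfolding p by blast
    from canonical_step[OF IH(2) e' src'] obtain us' r' d where step: "canonical us' r'" "p' @ v @ q = blocks us'"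
      "d = [] \<or> (\<exists>k g. is_path (squier_complex P) w g w \<and> d = loop_at k g)"
      "homotopic K [rend] (blocks us') (r0 @ [(p', u, v, q)]) (d @ r')" by blast
    have y': "y = lend # blocks us'" using y p step(2) by simp
    have "homotopic K base y (in_context [lend] [] r0 @ [e]) (in_context [lend] [] d @ in_context [lend] [] r')"
      using homotopic_left[OF step(4) l] by (simp add: e p y')
    then have "homotopic K base y (h @ in_context [lend] [] r0 @ [e])
        ((h @ in_context [lend] [] d) @ in_context [lend] [] r')"
      using homotopic_appendL[OF hp] by simp
    with re have "homotopic K base y (r @ [e]) ((h @ in_context [lend] [] d) @ in_context [lend] [] r')"
      by (rule homotopic.trans)
    moreover have "generated_loop (h @ in_context [lend] [] d)"
      using step(3) IH(3) generated_loop_append[OF IH(3) generated_loop_at] by auto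
    ultimately show ?thesis using y' step(1) by blast
  next
    case Nil
    have rel: "(u, v) \<in> relations Q \<or> (v, u) \<in> relations Q" using edge by (simp add: squier_edges_iff)
    have "u \<noteq> []" using rel presQ by (auto simp: is_presentation_def)
    with src Nil obtain u' where u: "u = lend # u'" by (cases u) auto
    with rel consider "u = lend # block w" "v = [lend]" | "u = [lend]" "v = lend # block w"
      by (auto elim!: wreath_relation_cases simp: block_def Cons_eq_map_conv)
    then show ?thesis
    proof cases
      case 1
      have bq: "block w @ q = blocks us" using src Nil 1 by simp
      then obtain x us' where us: "us = x # us'" by (cases us) (auto simp: blocks_simps block_def)
      with bq have xq: "x = w" "q = blocks us'" by (auto simp: blocks_simps block_def Inl_list_Inr_eq)
      from IH(2) obtain g r' where can: "is_path (squier_complex P) w g w" "canonical us' r'"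
        "r0 = add_block w @ in_context [] [rend] (in_block g) @ in_context (block w) [] r'"
        unfolding us xq by (auto elim: canonical.cases)
      have r': "is_path K [rend] r' (blocks us')" by (rule canonical_path[OF can(2)])
      let ?i = "in_context [lend] [] (add_block w)"
      let ?g = "in_context [lend] [rend] (in_block g)"
      let ?l = "in_context [] [rend] (absorb_block w)"
      let ?r = "in_context [lend] [] r'"
      let ?b = "lend # block w @ [rend]"
      have gp: "is_path K ?b ?g ?b"
        using path_left[OF path_right[OF in_block_path[OF can(1)], of "[rend]"] l] lists_Q by simp
      have rp: "is_path K base ?r y"
        using path_left[OF r' l] y Nil 1 xq by simp
      have y': "y = lend # blocks us'" using y Nil 1 xq by simp
      have "homotopic K ?b y (in_context (lend # block w) [] r' @ in_context [] (blocks us') (absorb_block w))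
          (?l @ ?r)"
        using homotopic.sym[OF interchange[OF presQ absorb_block_path r']] y' by simp
      from homotopic_appendL[OF is_path_appendI[OF add_path gp] this]
      have "homotopic K base y (in_context [lend] [] r0 @ [e]) ((?i @ ?g) @ [] @ (?l @ ?r))"
        using Nil 1 xq by (simp add: can(3) e absorb_block_def)
      also have "homotopic K base y ((?i @ ?g) @ [] @ (?l @ ?r))
          ((?i @ ?g) @ (inv_path K ?i @ ?i) @ (?l @ ?r))"
        by (rule homotopic_context[OF homotopic.sym[OF K.homotopic_inv_path_left[OF add_path]]
              is_path_appendI[OF add_path gp] is_path_appendI[OF absorb_path rp]])
      finally have "homotopic K base y (in_context [lend] [] r0 @ [e])
          ((in_context [lend] [] (loop_at 0 g) @ shift_loop) @ ?r)"
        by (simp add: shift_loop_def inv_path_in_context)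
      from homotopic.trans[OF re homotopic_appendL[OF hp this]]
      have "homotopic K base y (r @ [e]) ((h @ in_context [lend] [] (loop_at 0 g) @ shift_loop) @ ?r)"
        by simp
      moreover have "generated_loop (h @ in_context [lend] [] (loop_at 0 g) @ shift_loop)"
        by (intro generated_loop_append IH(3) generated_loop_at[OF can(1)] generated_shift_loop)
      ultimately show ?thesis using y' can(2) by blast
    next
      case 2
      have q: "q = blocks us" using src Nil 2 by simp
      let ?i = "in_context [lend] [] (add_block w)"
      let ?l = "in_context [] [rend] (absorb_block w)"
      let ?br = "in_context (lend # block w) [] r0"
      let ?r' = "add_block w @ in_context [] [rend] (in_block []) @ in_context (block w) [] r0"
      have can: "canonical (w # us) ?r'"
        using canonical.Cons[OF _ IH(2), of "[]" w] w by simp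
      have y': "y = lend # blocks (w # us)" using y Nil 2 q by (simp add: blocks_simps)
      have lp: "is_path K [lend] (inv_path K (absorb_block w)) (lend # block w)"
        by (rule K.is_path_inv_path[OF absorb_block_path])
      have brp: "is_path K (lend # block w @ [rend]) ?br y"
        using path_left[OF r0, of "lend # block w"] lists_Q(2) block_w_lists y' by (simp add: blocks_simps)
      have "homotopic K base y (in_context [lend] [] r0 @ [e]) (inv_path K ?l @ [] @ ?br)"
        using homotopic.sym[OF interchange[OF presQ lp r0]] y' Nil 2 q
        by (simp add: inv_path_in_context e absorb_block_def inv_path_def blocks_simps)
      also have "homotopic K base y (inv_path K ?l @ [] @ ?br) (inv_path K ?l @ (inv_path K ?i @ ?i) @ ?br)"
        by (rule homotopic_context[OF homotopic.sym[OF K.homotopic_inv_path_left[OF add_path]]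
              K.is_path_inv_path[OF absorb_path] brp])
      finally have "homotopic K base y (in_context [lend] [] r0 @ [e])
          (inv_path K shift_loop @ in_context [lend] [] ?r')"
        by (simp add: shift_loop_def inv_path_append)
      from homotopic.trans[OF re homotopic_appendL[OF hp this]]
      have "homotopic K base y (r @ [e]) ((h @ inv_path K shift_loop) @ in_context [lend] [] ?r')"
        by simp
      moreover have "generated_loop (h @ inv_path K shift_loop)"
        by (intro generated_loop_append IH(3) generated_shift_loop)
      ultimately show ?thesis using y' can by blast
    qed
  qed
qed

lemma generate_F: "carrier F = generate F wreath_generators"
proof
  interpret F: group F by (rule group_F)
  show "generate F wreath_generators \<subseteq> carrier F"
    using F.generate_incl[OF wreath_generators_closed] .
  show "carrier F \<subseteq> generate F wreath_generators"
  proof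
    fix A assume "A \<in> carrier F"
    then obtain r where r: "is_path K base r base" "A = homotopy_class K base r"
      by (rule fundamental_group_cases)
    from path_normal_form[OF r(1)] obtain us r' h where nf: "base = lend # blocks us" "canonical us r'"
      "generated_loop h" "homotopic K base base r (h @ in_context [lend] [] r')" by blast
    from nf(1) have "us = []" by (cases us) (auto simp: blocks_simps block_def)
    with nf(2) have "r' = []" by (auto elim: canonical.cases)
    with nf r(2) have "A = homotopy_class K base h" using homotopy_class_eq_iff[OF r(1)] by simp
    with nf(3) show "A \<in> generate F wreath_generators" by (simp add: generated_loop_def)
  qed
qed

end


section \<open>The labelling by the wreath product\<close>

text \<open>
  The letters of P adjacent to a rewriting step inside a block: together with the step they form an
  edge of the Squier complex of P.
\<close>

definition right_inner :: "('a + nat) list \<Rightarrow> 'a list" where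
  "right_inner q = map projl (takeWhile isl q)"

definition left_inner :: "('a + nat) list \<Rightarrow> 'a list" where
  "left_inner p = map projl (rev (takeWhile isl (rev p)))"

lemma list_all_isl_map_Inl [simp]: "list_all isl (map Inl x)"
  by (simp add: list_all_iff)

lemma takeWhile_isl_map_Inl [simp]:
  "takeWhile isl (map Inl x @ y) = map Inl x @ takeWhile isl y"
  "takeWhile isl (map Inl x) = map Inl x"
  by (induction x) auto

lemma takeWhile_isl_Inr [simp]: "takeWhile isl (z @ Inr k # y) = takeWhile isl z"
  by (induction z) auto

lemma right_inner_simps [simp]:
  "right_inner [] = []"
  "right_inner (map Inl x @ q) = x @ right_inner q"
  "right_inner (map Inl x) = x"
  "right_inner (q @ Inr k # q') = right_inner q"
  by (simp_all add: right_inner_def o_def)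

lemma left_inner_simps [simp]:
  "left_inner [] = []"
  "left_inner (p @ map Inl x) = left_inner p @ x"
  "left_inner (map Inl x) = x"
  "left_inner (Inr k # p) = left_inner p"
  by (simp_all add: left_inner_def rev_map o_def)

lemma right_inner_append: "\<not> list_all isl z \<Longrightarrow> right_inner (z @ q) = right_inner z"
  by (auto simp: right_inner_def list_all_iff)

lemma left_inner_append: "\<not> list_all isl z \<Longrightarrow> left_inner (p @ z) = left_inner z"
  by (auto simp: left_inner_def list_all_iff)

lemma count_list_map_Inl [simp]: "count_list (map Inl x) (Inr k) = 0"
  by (induction x) auto

lemma all_isl_or_separator:
  obtains x where "z = map Inl x" | x k y where "z = map Inl x @ Inr k # y"
proof -
  have "(\<exists>x. z = map Inl x) \<or> (\<exists>x k y. z = map Inl x @ Inr k # y)"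
  proof (induction z)
    case (Cons a z)
    show ?case
    proof (cases a)
      case (Inl b)
      with Cons show ?thesis by (metis append_Cons list.simps(9))
    qed (metis append_Nil list.simps(8))
  qed simp
  then show thesis using that by blast
qed

locale wreath_labelling = wreath_setup P w
  for P :: "'a semigroup_presentation" and w :: "'a list" +
  fixes G :: "('g, 'm) monoid_scheme" and \<rho> :: "'a edge \<Rightarrow> 'g"
  assumes group_G: "group G"
    and \<rho>_closed: "\<rho> e \<in> carrier G"
    and \<rho>_homotopic: "homotopic (squier_complex P) u v r s \<Longrightarrow> path_label G \<rho> r = path_label G \<rho> s"
    and \<rho>_faithful: "is_path (squier_complex P) w r w \<Longrightarrow> is_path (squier_complex P) w s w \<Longrightarrow>
      path_label G \<rho> r = path_label G \<rho> s \<Longrightarrow> homotopic (squier_complex P) w w r s"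
    and \<rho>_surj: "g \<in> carrier G \<Longrightarrow> \<exists>r. is_path (squier_complex P) w r w \<and> path_label G \<rho> r = g"
begin

abbreviation "W \<equiv> wreath_Z G"

sublocale G: group G by (rule group_G)
sublocale W: group W by (rule group_wreath_Z[OF group_G])
sublocale SP: serre_complex "squier_complex P" by (rule serre_squier_complex)

lemmas wreath_simps [simp] =
  wreath_base_closed[OF group_G] wreath_shift_closed[OF group_G] wreath_shift_mult[OF group_G]

text \<open>
  The number of closing brackets to the left of a step is the position of its block. The last case
  consists of the creation and the deletion of blocks at the right end.
\<close>

definition wreath_label :: "('a + nat) edge \<Rightarrow> (int \<Rightarrow> 'g) \<times> int" where
  "wreath_label = (\<lambda>(p, u, v, q).
    if u = lend # block w then wreath_shift G 1
    else if u = [lend] then wreath_shift G (-1)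
    else if list_all isl u then
      wreath_base G (int (count_list p rbr)) (\<rho> (left_inner p, map projl u, map projl v, right_inner q))
    else \<one>\<^bsub>W\<^esub>)"

lemma wreath_label_closed [simp]: "wreath_label e \<in> carrier W"
  by (cases e) (auto simp: wreath_label_def \<rho>_closed)

lemma wreath_label_inner:
  "u \<noteq> [] \<Longrightarrow> wreath_label (p, map Inl u, map Inl v, q) =
    wreath_base G (int (count_list p rbr)) (\<rho> (left_inner p, u, v, right_inner q))"
  by (cases u) (auto simp: wreath_label_def o_def)

lemma wreath_label_left:
  "wreath_label (p, lend # block w, v, q) = wreath_shift G 1"
  "wreath_label (p, [lend], v, q) = wreath_shift G (-1)"
  by (simp_all add: wreath_label_def block_def)

lemma wreath_label_right:
  "wreath_label (p, block w @ [rend], v, q) = \<one>\<^bsub>W\<^esub>" "wreath_label (p, [rend], v, q) = \<one>\<^bsub>W\<^esub>"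
  by (simp_all add: wreath_label_def block_def)

lemma relation_nonempty:
  "(u, v) \<in> relations P \<Longrightarrow> u \<noteq> [] \<and> v \<noteq> []"
  using pres by (auto simp: is_presentation_def)

lemma \<rho>_inverse:
  assumes "(p, u, v, q) \<in> squier_edges P"
  shows "\<rho> (p, u, v, q) \<otimes>\<^bsub>G\<^esub> \<rho> (p, v, u, q) = \<one>\<^bsub>G\<^esub>"
  using \<rho>_homotopic[OF SP.homotopic_inv_path_right[OF is_path_edge[OF pres assms]]]
  by (simp add: inv_path_def \<rho>_closed)

lemma inner_lists:
  "p \<in> lists (alphabet Q) \<Longrightarrow> left_inner p \<in> lists (alphabet P)"
  "p \<in> lists (alphabet Q) \<Longrightarrow> right_inner p \<in> lists (alphabet P)"
proof -
  have alph: "projl a \<in> alphabet P" if "a \<in> alphabet Q" "isl a" for a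
    using that by (auto simp: wreath_presentation_def)
  show "p \<in> lists (alphabet Q) \<Longrightarrow> left_inner p \<in> lists (alphabet P)"
    "p \<in> lists (alphabet Q) \<Longrightarrow> right_inner p \<in> lists (alphabet P)"
    by (auto simp: left_inner_def right_inner_def dest!: set_takeWhileD intro!: alph)
qed

lemma wreath_label_inverse:
  assumes "e \<in> squier_edges Q"
  shows "wreath_label e \<otimes>\<^bsub>W\<^esub> wreath_label (squier_inv e) = \<one>\<^bsub>W\<^esub>"
proof -
  have inner: "wreath_label (p, map Inl u, map Inl v, q) \<otimes>\<^bsub>W\<^esub> wreath_label (p, map Inl v, map Inl u, q) = \<one>\<^bsub>W\<^esub>"
    if "(u, v) \<in> relations P \<or> (v, u) \<in> relations P" "p \<in> lists (alphabet Q)" "q \<in> lists (alphabet Q)"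
    for p u v q
  proof -
    have "u \<noteq> []" "v \<noteq> []" using that(1) relation_nonempty by blast+
    moreover have "(left_inner p, u, v, right_inner q) \<in> squier_edges P"
      using that inner_lists by (simp add: squier_edges_iff del: in_lists_conv_set)
    ultimately show ?thesis
      by (simp add: wreath_label_inner wreath_base_mult[OF group_G] \<rho>_closed \<rho>_inverse
          wreath_base_one[OF group_G])
  qed
  obtain p u v q where e: "e = (p, u, v, q)" by (meson prod_cases4)
  have pq: "p \<in> lists (alphabet Q)" "q \<in> lists (alphabet Q)"
    and "(u, v) \<in> relations Q \<or> (v, u) \<in> relations Q"
    using assms by (auto simp: squier_edges_iff e)
  from this(3) show ?thesis
  proof
    assume "(u, v) \<in> relations Q"
    then show ?thesis
      by (cases rule: wreath_relation_cases)
        (use inner pq in \<open>auto simp: e wreath_label_left wreath_label_right wreath_shift_0[OF group_G]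
          simp del: in_lists_conv_set\<close>)
  next
    assume "(v, u) \<in> relations Q"
    then show ?thesis
      by (cases rule: wreath_relation_cases)
        (use inner pq in \<open>auto simp: e wreath_label_left wreath_label_right wreath_shift_0[OF group_G]
          simp del: in_lists_conv_set\<close>)
  qed
qed

text \<open>
  Since the word decomposes into blocks, a step at the left end is never the second of the two and a
  step at the right end never the first. Without this assumption the claim fails: a step at the left
  end does not commute with a step in a block on its left.
\<close>

lemma wreath_label_square:
  assumes r1: "(l1, r1) \<in> relations Q" and r2: "(l2, r2) \<in> relations Q"
    and pq: "p \<in> lists (alphabet Q)" "z \<in> lists (alphabet Q)" "q \<in> lists (alphabet Q)"
    and src: "p @ l1 @ z @ l2 @ q = lend # blocks us"
  shows "wreath_label (p, l1, r1, z @ l2 @ q) \<otimes>\<^bsub>W\<^esub> wreath_label (p @ r1 @ z, l2, r2, q) =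
    wreath_label (p @ l1 @ z, l2, r2, q) \<otimes>\<^bsub>W\<^esub> wreath_label (p, l1, r1, z @ r2 @ q)"
proof -
  have ne: "l1 \<noteq> []" "l2 \<noteq> []" using r1 r2 presQ by (auto simp: is_presentation_def)
  have not_right: "l1 \<noteq> block w @ [rend]"
  proof
    assume l1: "l1 = block w @ [rend]"
    show False
    proof (cases p)
      case Nil
      then show False using src l1 by (simp add: block_def)
    next
      case (Cons a p')
      then have "(p' @ block w) @ rend # (z @ l2 @ q) = blocks us" using src l1 by simp
      from rend_in_blocks[OF this] ne show False by simp
    qed
  qed
  have not_left: "l2 \<noteq> lend # block w"
  proof
    assume l2: "l2 = lend # block w"
    obtain a y where y: "p @ l1 = a # y" using ne by (cases "p @ l1") auto
    then have "(p @ l1) @ z @ l2 @ q = a # y @ z @ l2 @ q" by simp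
    then have "blocks us = y @ z @ l2 @ q" using src by simp
    then have "lend \<in> set (blocks us)" using l2 by simp
    then show False using lend_notin_blocks by blast
  qed
  from r1 show ?thesis
  proof (cases rule: wreath_relation_cases)
    case right
    then show ?thesis using not_right by simp
  next
    case left
    note l1 = left
    have z: "left_inner (p @ lend # z) = left_inner z"
      "left_inner (p @ lend # block w @ z) = left_inner z"
      "count_list (block w) rbr = 1"
      using left_inner_append[of "lend # z" p] left_inner_append[of "lend # block w @ z" p]
        left_inner_append[of "rbr # z" "lbr # map Inl w"]
      by (simp_all add: block_def count_list_append)
    from r2 show ?thesis
    proof (cases rule: wreath_relation_cases)
      case (inner u v)
      then have "u \<noteq> []" using relation_nonempty by blast
      then show ?thesis
        using wreath_shift_base[OF group_G \<rho>_closed, of 1] inner l1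
        by (simp add: wreath_label_inner wreath_label_left z count_list_append algebra_simps)
    next
      case left
      then show ?thesis using not_left by simp
    next
      case right
      then show ?thesis using l1 by (simp add: wreath_label_left wreath_label_right)
    qed
  next
    case (inner u1 v1)
    note l1 = inner
    then have u1: "u1 \<noteq> []" and v1: "v1 \<noteq> []" using relation_nonempty by blast+
    from r2 show ?thesis
    proof (cases rule: wreath_relation_cases)
      case left
      then show ?thesis using not_left by simp
    next
      case right
      have "right_inner (z @ block w @ rend # q) = right_inner z" by (simp add: block_def)
      then show ?thesis using right l1 u1
        by (simp add: wreath_label_inner wreath_label_right \<rho>_closed)
    next
      case (inner u2 v2)
      note l2 = inner
      then have u2: "u2 \<noteq> []" and v2: "v2 \<noteq> []" using relation_nonempty by blast+
      show ?thesis
      proof (cases z rule: all_isl_or_separator)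
        \<comment> \<open>Both steps are in the same block, and the square is one of P.\<close>
        case (1 x)
        have x: "x \<in> lists (alphabet P)" using inner_lists(2)[OF pq(2)] right_inner_simps(2)[of x "[]"] 1 by simp
        have li: "left_inner (p @ map Inl a @ map Inl b) = left_inner p @ a @ b" for a b
          using left_inner_simps(2)[of p "a @ b"] by simp
        have "homotopic (squier_complex P) (left_inner p @ u1 @ x @ [] @ u2 @ right_inner q)
          (left_inner p @ v1 @ x @ [] @ v2 @ right_inner q)
          [(left_inner p, u1, v1, x @ [] @ u2 @ right_inner q), (left_inner p @ v1 @ x @ [], u2, v2, right_inner q)]
          [(left_inner p @ u1 @ x @ [], u2, v2, right_inner q), (left_inner p, u1, v1, x @ [] @ v2 @ right_inner q)]"
          by (rule interchange_edges[OF pres]) (use l1 l2 x pq inner_lists in \<open>simp_all add: squier_edges_iff del: in_lists_conv_set\<close>)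
        from \<rho>_homotopic[OF this] show ?thesis
          by (simp add: l1 l2 1 wreath_label_inner u1 u2 li count_list_append \<rho>_closed
              wreath_base_mult[OF group_G])
      next
        \<comment> \<open>The steps are in different blocks.\<close>
        case (2 x k y)
        have sep: "\<not> list_all isl z" by (simp add: 2)
        have "Inr k = (rbr :: 'a + nat)"
        proof (cases p)
          case Nil
          then show ?thesis using src l1 u1 by (cases u1) auto
        next
          case (Cons a p')
          then show ?thesis
            using after_inner_in_blocks[of p' u1 x k "y @ l2 @ q" us] src l1 u1 2 by simp
        qed
        then have "count_list p rbr \<noteq> count_list (p @ map Inl v @ z) rbr" for v :: "'a list"
          by (simp add: 2 count_list_append)
        moreover have "count_list (p @ map Inl v1 @ z) rbr = count_list (p @ map Inl u1 @ z) rbr"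
          by (simp add: count_list_append)
        ultimately show ?thesis
          using wreath_base_commute[OF group_G \<rho>_closed \<rho>_closed]
          by (simp add: l1 l2 wreath_label_inner u1 u2 left_inner_append right_inner_append sep)
      qed
    qed
  qed
qed

lemma wreath_label_homotopic:
  assumes "homotopic K base y r s"
  shows "path_label W wreath_label r = path_label W wreath_label s"
proof (rule W.path_label_homotopic[OF _ _ _ assms])
  fix r e y assume "is_path K base (r @ [e, inv_edge K e]) y"
  then have "e \<in> squier_edges Q" by (auto simp: is_path_append)
  then show "path_label W wreath_label [e, inv_edge K e] = \<one>\<^bsub>W\<^esub>"
    using wreath_label_inverse by simp
next
  fix r c y assume c: "c \<in> cells K" "is_path K base (r @ c) y"
  from c(1)[unfolded squier_complex_simps]
  show "path_label W wreath_label c = \<one>\<^bsub>W\<^esub>"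
  proof (rule squier_cellsE)
    fix p z q l1 r1 l2 r2
    assume *: "p \<in> lists (alphabet Q)" "z \<in> lists (alphabet Q)" "q \<in> lists (alphabet Q)"
      "(l1, r1) \<in> relations Q" "(l2, r2) \<in> relations Q"
      "c = [(p, l1, r1, z @ l2 @ q), (p @ r1 @ z, l2, r2, q),
         (p, r1, l1, z @ r2 @ q), (p @ l1 @ z, r2, l2, q)]"
    obtain x where x: "is_path K base r x" "is_path K x c y" using c(2) by (auto simp: is_path_append)
    then have "x = p @ l1 @ z @ l2 @ q" by (simp add: *(6))
    with path_normal_form[OF x(1)] obtain us where src: "p @ l1 @ z @ l2 @ q = lend # blocks us" by auto
    let ?f1 = "(p @ l1 @ z, l2, r2, q)" and ?f2 = "(p, l1, r1, z @ r2 @ q)"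
    have edges: "?f1 \<in> squier_edges Q" "?f2 \<in> squier_edges Q"
      using * presQ by (auto simp: squier_edges_iff is_presentation_def)
    have "path_label W wreath_label c = wreath_label (p, l1, r1, z @ l2 @ q) \<otimes>\<^bsub>W\<^esub>
        wreath_label (p @ r1 @ z, l2, r2, q) \<otimes>\<^bsub>W\<^esub>
        (wreath_label (squier_inv ?f2) \<otimes>\<^bsub>W\<^esub> wreath_label (squier_inv ?f1))"
      by (simp add: *(6) W.m_assoc)
    also have "\<dots> = wreath_label ?f1 \<otimes>\<^bsub>W\<^esub> (wreath_label ?f2 \<otimes>\<^bsub>W\<^esub> wreath_label (squier_inv ?f2)) \<otimes>\<^bsub>W\<^esub>
        wreath_label (squier_inv ?f1)"
      by (simp add: wreath_label_square[OF *(4,5,1,2,3) src] W.m_assoc)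
    also have "\<dots> = \<one>\<^bsub>W\<^esub>"
      using wreath_label_inverse[OF edges(1)] wreath_label_inverse[OF edges(2)] by simp
    finally show ?thesis .
  qed
qed simp


section \<open>The isomorphism\<close>

definition class_label :: "('a + nat) edge list set \<Rightarrow> (int \<Rightarrow> 'g) \<times> int" where
  "class_label A = path_label W wreath_label (SOME r. r \<in> A)"

lemma class_label_class:
  assumes "is_path K base r base"
  shows "class_label (homotopy_class K base r) = path_label W wreath_label r"
proof -
  have "r \<in> homotopy_class K base r"
    using assms by (auto simp: homotopy_rel_def intro: homotopic.refl)
  then have "(SOME s. s \<in> homotopy_class K base r) \<in> homotopy_class K base r" by (rule someI)
  then have "homotopic K base base r (SOME s. s \<in> homotopy_class K base r)"
    by (simp add: homotopy_rel_def)
  from wreath_label_homotopic[OF this] show ?thesis by (simp add: class_label_def)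
qed

lemma class_label_hom: "class_label \<in> hom F W"
proof (rule homI)
  fix A assume "A \<in> carrier F"
  then show "class_label A \<in> carrier W"
    by (elim fundamental_group_cases) (simp add: class_label_class)
next
  fix A B assume "A \<in> carrier F" "B \<in> carrier F"
  then show "class_label (A \<otimes>\<^bsub>F\<^esub> B) = class_label A \<otimes>\<^bsub>W\<^esub> class_label B"
    by (elim fundamental_group_cases)
      (simp add: mult_homotopy_class class_label_class is_path_appendI W.path_label_append)
qed

definition loop_rep :: "'g \<Rightarrow> 'a edge list" where
  "loop_rep g = (SOME r. is_path (squier_complex P) w r w \<and> path_label G \<rho> r = g)"

lemma loop_rep:
  assumes "g \<in> carrier G"
  shows "is_path (squier_complex P) w (loop_rep g) w" "path_label G \<rho> (loop_rep g) = g"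
  using someI_ex[OF \<rho>_surj[OF assms]] by (simp_all add: loop_rep_def)

definition base_class :: "'g \<Rightarrow> ('a + nat) edge list set" where
  "base_class g = homotopy_class K base (in_context [lend] [] (loop_at 0 (loop_rep g)))"

lemma base_loop_homotopic:
  assumes "homotopic (squier_complex P) w w g h"
  shows "homotopic K base base (in_context [lend] [] (loop_at 0 g)) (in_context [lend] [] (loop_at 0 h))"
proof -
  have "homotopic K (block w @ [rend]) (block w @ [rend])
      (in_context [] [rend] (in_block g)) (in_context [] [rend] (in_block h))"
    using homotopic_in_context[of "[]" Q "[rend]", OF _ _ in_block_homotopic[OF assms]] lists_Q by simp
  from homotopic_context[OF this add_block_path K.is_path_inv_path[OF add_block_path]]
  show ?thesis using homotopic_left[of "[rend]" "[rend]" "loop_at 0 g" "loop_at 0 h" "[lend]"] lists_Q by simp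
qed

lemma base_loop_append:
  assumes g: "is_path (squier_complex P) w g w" and h: "is_path (squier_complex P) w h w"
  shows "homotopic K base base (in_context [lend] [] (loop_at 0 (g @ h)))
    (in_context [lend] [] (loop_at 0 g) @ in_context [lend] [] (loop_at 0 h))"
proof -
  let ?i = "add_block w" and ?b = "block w @ [rend]"
  let ?g = "\<lambda>g. in_context [] [rend] (in_block g)"
  note ip = add_block_path and jp = K.is_path_inv_path[OF add_block_path]
  have p: "is_path K ?b (?g g) ?b" if "is_path (squier_complex P) w g w" for g
    using path_right[OF in_block_path[OF that], of "[rend]"] lists_Q by simp
  have "homotopic K [rend] [rend] ((?i @ ?g g) @ [] @ (?g h @ inv_path K ?i))
      ((?i @ ?g g) @ (inv_path K ?i @ ?i) @ (?g h @ inv_path K ?i))"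
    by (rule homotopic_context[OF homotopic.sym[OF K.homotopic_inv_path_left[OF ip]]
          is_path_appendI[OF ip p[OF g]] is_path_appendI[OF p[OF h] jp]])
  from homotopic_left[OF this, of "[lend]"] show ?thesis using lists_Q by simp
qed

lemma base_class_eq:
  assumes "is_path (squier_complex P) w r w"
  shows "homotopy_class K base (in_context [lend] [] (loop_at 0 r)) = base_class (path_label G \<rho> r)"
proof -
  have "path_label G \<rho> r \<in> carrier G" by (simp add: \<rho>_closed)
  note rep = loop_rep[OF this]
  from base_loop_homotopic[OF \<rho>_faithful[OF assms rep(1)]] rep(2) show ?thesis
    unfolding base_class_def
    using homotopy_class_eq_iff[OF base_loop_path[OF loop_at_path[OF assms]]]
    by (simp del: loop_at.simps)
qed

lemma base_class_hom: "base_class \<in> hom G F"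
proof (rule homI)
  note path = base_loop_path[OF loop_at_path[OF loop_rep(1)]]
  show "base_class g \<in> carrier F" if "g \<in> carrier G" for g
    unfolding base_class_def by (rule homotopy_class_in_carrier[OF path[OF that]])
  fix g h assume gh: "g \<in> carrier G" "h \<in> carrier G"
  note g = loop_rep[OF gh(1)] and h = loop_rep[OF gh(2)]
  have "base_class (g \<otimes>\<^bsub>G\<^esub> h) = base_class (path_label G \<rho> (loop_rep g @ loop_rep h))"
    by (simp add: g h G.path_label_append \<rho>_closed)
  also have "\<dots> = homotopy_class K base (in_context [lend] [] (loop_at 0 (loop_rep g @ loop_rep h)))"
    by (rule base_class_eq[OF is_path_appendI[OF g(1) h(1)], symmetric])
  also have "\<dots> = homotopy_class K base (in_context [lend] [] (loop_at 0 (loop_rep g)) @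
      in_context [lend] [] (loop_at 0 (loop_rep h)))"
    by (rule homotopy_class_eq_iff[OF base_loop_path[OF loop_at_path[OF is_path_appendI[OF g(1) h(1)]]],
          THEN iffD2, OF base_loop_append[OF g(1) h(1)]])
  also have "\<dots> = base_class g \<otimes>\<^bsub>F\<^esub> base_class h"
    unfolding base_class_def by (rule mult_homotopy_class[OF path[OF gh(1)] path[OF gh(2)], symmetric])
  finally show "base_class (g \<otimes>\<^bsub>G\<^esub> h) = base_class g \<otimes>\<^bsub>F\<^esub> base_class h" .
qed

lemma class_label_iso: "class_label \<in> iso F W"
proof (rule wreath_Z_recognition[where T = "homotopy_class K base shift_loop" and \<tau> = base_class,
      OF group_G group_F class_label_hom])
  let ?T = "homotopy_class K base shift_loop"
  show "?T \<in> carrier F" by (rule homotopy_class_in_carrier[OF shift_loop_path])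
  show "base_class \<in> hom G F" by (rule base_class_hom)
  have "path_label W wreath_label shift_loop = wreath_shift G 1"
    by (simp add: shift_loop_def add_block_def absorb_block_def wreath_label_left wreath_label_right)
  then show "class_label ?T = wreath_shift G 1" by (simp add: class_label_class[OF shift_loop_path])
  show "class_label (base_class g) = wreath_base G 0 g" if g: "g \<in> carrier G" for g
  proof -
    have "path_label W wreath_label (in_context [lend] [rend] (in_block r)) = wreath_base G 0 (path_label G \<rho> r)"
      if "is_path (squier_complex P) x r y" for x r y
      using that
    proof (induction r arbitrary: x)
      case Nil
      then show ?case by (simp add: wreath_base_one[OF group_G])
    next
      case (Cons e r)
      obtain p u v q where e: "e = (p, u, v, q)" by (meson prod_cases4)
      have "u \<noteq> []" using Cons.prems relation_nonempty by (auto simp: e squier_edges_iff)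
      then show ?case using Cons
        by (auto simp: e in_block_def wreath_label_inner count_list_append \<rho>_closed
            wreath_base_mult[OF group_G])
    qed
    from this[OF loop_rep(1)[OF g]]
    have "path_label W wreath_label (in_context [lend] [] (loop_at 0 (loop_rep g))) = wreath_base G 0 g"
      using g by (simp add: loop_rep(2) W.path_label_append add_block_def inv_path_def wreath_label_right)
    then show ?thesis
      unfolding base_class_def
      by (simp only: class_label_class[OF base_loop_path[OF loop_at_path[OF loop_rep(1)[OF g]]]])
  qed
  have "wreath_generators \<subseteq> insert ?T (base_class ` carrier G)"
    unfolding wreath_generators_def using base_class_eq by (auto simp: \<rho>_closed simp del: loop_at.simps)
  then show "carrier F \<subseteq> generate F (insert ?T (base_class ` carrier G))"
    unfolding generate_F by (rule group.mono_generate[OF group_F])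
  fix g h :: 'g and n :: nat
  assume g: "g \<in> carrier G" and h: "h \<in> carrier G" and n: "n > 0"
  then obtain k where k: "n = Suc k" by (cases n) auto
  note gp = loop_rep(1)[OF g] and hp = loop_rep(1)[OF h]
  have p: "is_path K base (in_context [lend] [] (loop_at k r)) base"
    if "is_path (squier_complex P) w r w" for k r
    by (rule base_loop_path[OF loop_at_path[OF that]])
  have conj: "?T [^]\<^bsub>F\<^esub> n \<otimes>\<^bsub>F\<^esub> base_class h \<otimes>\<^bsub>F\<^esub> inv\<^bsub>F\<^esub> (?T [^]\<^bsub>F\<^esub> n) =
      homotopy_class K base (in_context [lend] [] (loop_at (Suc k) (loop_rep h)))"
    unfolding base_class_def k by (rule loop_at_conjugate[OF hp, symmetric])
  let ?g = "in_context [lend] [] (loop_at 0 (loop_rep g))"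
  let ?h = "in_context [lend] [] (loop_at (Suc k) (loop_rep h))"
  have "homotopic K base base (?g @ ?h) (?h @ ?g)"
    using homotopic_left[OF loop_at_commute[OF gp hp, of k], of "[lend]"] lists_Q
    by (simp del: loop_at.simps)
  then have eq: "homotopy_class K base (?g @ ?h) = homotopy_class K base (?h @ ?g)"
    by (rule homotopy_class_eq_iff[OF is_path_appendI[OF p[OF gp] p[OF hp]], THEN iffD2])
  have "base_class g \<otimes>\<^bsub>F\<^esub> homotopy_class K base ?h = homotopy_class K base (?g @ ?h)"
    unfolding base_class_def by (rule mult_homotopy_class[OF p[OF gp] p[OF hp]])
  also note eq
  also have "homotopy_class K base (?h @ ?g) = homotopy_class K base ?h \<otimes>\<^bsub>F\<^esub> base_class g"
    unfolding base_class_def by (rule mult_homotopy_class[OF p[OF hp] p[OF gp], symmetric])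
  finally show "base_class g \<otimes>\<^bsub>F\<^esub> (?T [^]\<^bsub>F\<^esub> n \<otimes>\<^bsub>F\<^esub> base_class h \<otimes>\<^bsub>F\<^esub> inv\<^bsub>F\<^esub> (?T [^]\<^bsub>F\<^esub> n)) =
      ?T [^]\<^bsub>F\<^esub> n \<otimes>\<^bsub>F\<^esub> base_class h \<otimes>\<^bsub>F\<^esub> inv\<^bsub>F\<^esub> (?T [^]\<^bsub>F\<^esub> n) \<otimes>\<^bsub>F\<^esub> base_class g"
    by (simp only: conj)
qed

end

theorem theorem11:
  fixes G :: "('g, 'm) monoid_scheme"
  assumes "is_diagram_group TYPE('a) G"
  shows "is_diagram_group TYPE('a + nat) (wreath_Z G)"
proof -
  from assms obtain P :: "'a semigroup_presentation" and w where
    G: "group G" and pres: "is_presentation P" and w: "w \<in> nonempty_words (alphabet P)"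
    and iso: "G \<cong> fundamental_group (squier_complex P) w"
    unfolding is_diagram_group_def diagram_group_of_def by blast
  have wv: "w \<in> verts (squier_complex P)" using w by simp
  show ?thesis
  proof (rule serre_complex.ex_faithful_labelling[OF serre_squier_complex G iso wv])
    fix \<rho>
    assume rho: "\<And>e. \<rho> e \<in> carrier G"
      "\<And>u v r s. homotopic (squier_complex P) u v r s \<Longrightarrow> path_label G \<rho> r = path_label G \<rho> s"
      "\<And>r s. is_path (squier_complex P) w r w \<Longrightarrow> is_path (squier_complex P) w s w \<Longrightarrow>
        path_label G \<rho> r = path_label G \<rho> s \<Longrightarrow> homotopic (squier_complex P) w w r s"
      "\<And>g. g \<in> carrier G \<Longrightarrow> \<exists>r. is_path (squier_complex P) w r w \<and> path_label G \<rho> r = g"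
    interpret wreath_labelling P w G \<rho>
      by (intro wreath_labelling.intro wreath_setup.intro wreath_labelling_axioms.intro)
        (fact pres, fact w, fact G, rule rho(1), erule rho(2), erule (2) rho(3), erule rho(4))
    have "diagram_group_of Q base \<cong> wreath_Z G"
      using class_label_iso by (auto simp: diagram_group_of_def is_iso_def)
    then have "wreath_Z G \<cong> diagram_group_of Q base"
      using group.iso_sym[OF group_F] by (simp add: diagram_group_of_def)
    moreover have "base \<in> nonempty_words (alphabet Q)" using base_vert by simp
    ultimately show ?thesis
      unfolding is_diagram_group_def using group_wreath_Z[OF G] presQ by blast
  qed
qed


end
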